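(* For every $\varepsilon>0$ there exists a constant $c_{\varepsilon}>0$ such that $\vec\chi_{\ell}(KG(n,k))\geq c_{\varepsilon}\,n\ln n$ for all integers $n,k$ with $2\leq k\leq n^{\frac{1}{2}-\varepsilon}$.
   Context: The Kneser graph $KG(n,k)$ has vertex set $\binom{[n]}{k}$, two $k$-sets being adjacent iff they are disjoint. A $k$-list assignment to a digraph $D$ assigns to each vertex $v$ a set $L(v)$ of $k$ positive integers; a colouring $f$ is accepted if $f(v)\in L(v)$ for all $v$; it is proper if every colour class induces a subdigraph with no directed cycle. The list dichromatic number $\vec\chi_\ell(D)$ is the least $k$ such that every $k$-list assignment accepts a proper colouring; for an undirected graph $G$, $\vec\chi_\ell(G)$ is the maximum of $\vec\chi_\ell(D)$ over all orientations $D$ of $G$. *)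

theory Defs
  imports Complex_Main "Graph_Theory.Graph_Theory"
begin

definition proper_dicolouring :: "('a, 'b) pre_digraph \<Rightarrow> ('a \<Rightarrow> nat) \<Rightarrow> bool" where
  "proper_dicolouring D f \<longleftrightarrow>
     (\<forall>c. \<not> (\<exists>p. pre_digraph.cycle (D \<restriction> {v \<in> verts D. f v = c}) p))"

definition list_assignment :: "('a, 'b) pre_digraph \<Rightarrow> nat \<Rightarrow> ('a \<Rightarrow> nat set) \<Rightarrow> bool" where
  "list_assignment D k L \<longleftrightarrow>
     (\<forall>v \<in> verts D. L v \<subseteq> {1..} \<and> finite (L v) \<and> card (L v) = k)"

definition accepts :: "('a, 'b) pre_digraph \<Rightarrow> ('a \<Rightarrow> nat set) \<Rightarrow> ('a \<Rightarrow> nat) \<Rightarrow> bool" where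
  "accepts D L f \<longleftrightarrow> (\<forall>v \<in> verts D. f v \<in> L v)"

definition list_dicolourable :: "('a, 'b) pre_digraph \<Rightarrow> nat \<Rightarrow> bool" where
  "list_dicolourable D k \<longleftrightarrow>
     (\<forall>L. list_assignment D k L \<longrightarrow> (\<exists>f. accepts D L f \<and> proper_dicolouring D f))"

definition list_dichromatic_number :: "('a, 'b) pre_digraph \<Rightarrow> nat" where
  "list_dichromatic_number D = (LEAST k. list_dicolourable D k)"

text \<open>Undirected graphs are symmetric digraphs, as in the locale \<^locale>\<open>pair_graph\<close>;
  an orientation keeps exactly one of the two arcs representing each edge.\<close>

definition orientation :: "'a pair_pre_digraph \<Rightarrow> 'a pair_pre_digraph \<Rightarrow> bool" where
  "orientation G D \<longleftrightarrow> pverts D = pverts G \<and> parcs D \<subseteq> parcs G \<and>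
     (\<forall>(u, v) \<in> parcs G. (u, v) \<in> parcs D \<longleftrightarrow> (v, u) \<notin> parcs D)"

definition graph_list_dichromatic_number :: "'a pair_pre_digraph \<Rightarrow> nat" where
  "graph_list_dichromatic_number G =
     Max {list_dichromatic_number (with_proj D) | D. orientation G D}"

definition kneser_graph :: "nat \<Rightarrow> nat \<Rightarrow> nat set pair_pre_digraph" where
  "kneser_graph n k =
     (let V = {A. A \<subseteq> {1..n} \<and> card A = k}
      in \<lparr> pverts = V, parcs = {(A, B). A \<in> V \<and> B \<in> V \<and> A \<inter> B = {}} \<rparr>)"

text \<open>The least element and the maximum above are taken over nonempty, respectively finite
  nonempty, sets whenever the graph is finite and simple, as Kneser graphs with \<open>k > 0\<close> are.\<close>

lemma pair_graph_kneser_graph: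
  assumes "k > 0"
  shows "pair_graph (kneser_graph n k)"
proof
  let ?G = "kneser_graph n k"
  have verts: "A \<subseteq> {1..n} \<and> card A = k" if "A \<in> pverts ?G" for A
    using that by (simp add: kneser_graph_def)
  have arcs: "(A, B) \<in> parcs ?G \<longleftrightarrow> A \<in> pverts ?G \<and> B \<in> pverts ?G \<and> A \<inter> B = {}" for A B
    by (simp add: kneser_graph_def)
  show "finite (pverts ?G)"
    by (rule finite_subset[of _ "Pow {1..n}"]) (use verts in auto)
  then show "finite (parcs ?G)"
    by (intro finite_subset[of "parcs ?G" "pverts ?G \<times> pverts ?G"]) (auto simp: arcs)
  show "symmetric (with_proj ?G)"
    by (auto simp: symmetric_def arcs intro!: symI)
  fix e assume e: "e \<in> parcs ?G"
  obtain A B where [simp]: "e = (A, B)" by (cases e)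
  show "fst e \<in> pverts ?G" "snd e \<in> pverts ?G" using e by (simp_all add: arcs)
  show "fst e \<noteq> snd e" using e assms verts[of A] by (auto simp: arcs)
qed

lemma finite_orientations:
  assumes "pair_graph G"
  shows "finite {D. orientation G D}"
proof -
  interpret pair_graph G by fact
  have "{D. orientation G D} \<subseteq>
      (\<lambda>A. \<lparr> pverts = pverts G, parcs = A \<rparr>) ` Pow (parcs G)"
  proof
    fix D assume "D \<in> {D. orientation G D}"
    then show "D \<in> (\<lambda>A. \<lparr> pverts = pverts G, parcs = A \<rparr>) ` Pow (parcs G)"
      by (intro image_eqI[of _ _ "parcs D"]) (auto simp: orientation_def)
  qed
  then show ?thesis
    by (rule finite_subset) (use pair_finite_arcs in simp)
qed

lemma ex_orientation:
  assumes "pair_graph G"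
  shows "\<exists>D. orientation G D"
proof -
  interpret pair_graph G by fact
  obtain h :: "'a \<Rightarrow> nat" where h: "inj_on h (pverts G)"
    using pair_finite_verts finite_imp_inj_to_nat_seg by metis
  have sym: "(v, u) \<in> parcs G" if "(u, v) \<in> parcs G" for u v
    using pair_sym_arcs that by (auto simp: symmetric_def dest: symD)
  have "h u \<noteq> h v" if "(u, v) \<in> parcs G" for u v
    using h that in_arcsD1[OF that] in_arcsD2[OF that] pair_no_loops[OF that]
    by (auto dest: inj_onD)
  then have "orientation G \<lparr> pverts = pverts G, parcs = {(u, v) \<in> parcs G. h u < h v} \<rparr>"
    using sym by (fastforce simp: orientation_def)
  then show ?thesis ..
qed

lemma list_dicolourable_card_verts:
  assumes "loopfree_digraph D" "finite (verts D)"
  shows "list_dicolourable D (card (verts D))"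
  unfolding list_dicolourable_def
proof (intro allI impI)
  interpret loopfree_digraph D by fact
  fix L assume L: "list_assignment D (card (verts D)) L"
  have "\<exists>f. inj_on f S \<and> (\<forall>v \<in> S. f v \<in> L v)" if "S \<subseteq> verts D" for S
    using finite_subset[OF that assms(2)] that
  proof (induction S rule: finite_induct)
    case (insert x S)
    then obtain f where f: "inj_on f S" "\<forall>v \<in> S. f v \<in> L v" by auto
    have "card (f ` S) < card (L x)"
    proof -
      have "card (f ` S) \<le> card S" using insert by (simp add: card_image_le)
      also have "\<dots> < card (insert x S)" using insert by simp
      also have "\<dots> \<le> card (verts D)" by (rule card_mono[OF assms(2) insert.prems])
      finally show ?thesis using L insert by (auto simp: list_assignment_def)
    qed
    then have "\<not> L x \<subseteq> f ` S"
      using insert.hyps(1) by (meson card_mono finite_imageI leD)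
    then obtain c where "c \<in> L x" "c \<notin> f ` S" by blast
    then have "inj_on (f(x := c)) (insert x S) \<and> (\<forall>v \<in> insert x S. (f(x := c)) v \<in> L v)"
      using f insert.hyps by (auto simp: inj_on_def)
    then show ?case by blast
  qed auto
  then obtain f where f: "inj_on f (verts D)" "\<forall>v \<in> verts D. f v \<in> L v" by blast
  have "\<not> pre_digraph.cycle (D \<restriction> {v \<in> verts D. f v = c}) p" for c p
  proof
    assume cyc: "pre_digraph.cycle (D \<restriction> {v \<in> verts D. f v = c}) p"
    then obtain e where "e \<in> arcs (D \<restriction> {v \<in> verts D. f v = c})"
      by (cases p) (auto simp: pre_digraph.cycle_def pre_digraph.awalk_def)
    then have "e \<in> arcs D" "tail D e = head D e"
      using f(1) by (auto dest: inj_onD)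
    then show False using no_loops by blast
  qed
  with f show "\<exists>f. accepts D L f \<and> proper_dicolouring D f"
    by (auto simp: accepts_def proper_dicolouring_def)
qed

end

theory Submission
  imports Defs "HOL-Library.Ramsey" "HOL-Combinatorics.Multiset_Permutations"
    "HOL-Real_Asymp.Real_Asymp"
begin

text \<open>
  Orient the edges at random. A union bound over orderings shows that, for some orientation, every
  acyclic vertex set \<open>U\<close> spans at most \<open>d |U|\<close> edges, where \<open>d\<close> is about \<open>k log n\<close>. This is all that
  is used about the orientation.

  Such a sparse family \<open>F\<close> lies in one of few small containers. Either fewer than \<open>4 d\<close> members of \<open>F\<close>
  avoid some set \<open>S\<close> of fewer than \<open>t\<close> points, and \<open>F\<close> is a few sets plus sets meeting \<open>S\<close>; or
  \<open>F\<close> has a subfamily \<open>G\<close> of bounded size such that every \<open>S\<close> with fewer than \<open>t\<close> points is avoided by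
  at least \<open>4 d\<close> members of \<open>G\<close>. In the second case sparsity makes all but \<open>2 |G|\<close> members of \<open>F\<close>
  intersect most of \<open>G\<close>, and at most a fraction \<open>(2 k^2 / n)^t\<close> of all \<open>k\<close>-sets does so. A container
  therefore holds a fraction \<open>O(k / n)\<close> of the vertices.

  Give each vertex a random \<open>r\<close>-subset of \<open>2 r\<close> colours. If every colour is confined to a container,
  half of the vertices have at most \<open>s = O(r k / n)\<close> admissible colours, each list misses them
  with probability at least \<open>4^-s\<close>, and for \<open>r\<close> a small multiple of \<open>n ln n\<close> a union bound over the
  choices of the \<open>2 r\<close> containers leaves lists that no proper colouring respects.
\<close>

section \<open>Orientations with sparse acyclic sets\<close>

definition arc_orientations :: "('a \<times> 'a) set \<Rightarrow> ('a \<times> 'a) set set" where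
  "arc_orientations E = {D. D \<subseteq> E \<and> (\<forall>(u, v) \<in> E. (u, v) \<in> D \<longleftrightarrow> (v, u) \<notin> D)}"

lemma finite_arc_orientations: "finite E \<Longrightarrow> finite (arc_orientations E)"
  by (rule finite_subset[of _ "Pow E"]) (auto simp: arc_orientations_def)

lemma card_arc_orientations:
  fixes E :: "('a \<times> 'a) set"
  assumes E: "finite E" "sym E" "irrefl E"
  shows "card (arc_orientations E) = 2 ^ (card E div 2)"
proof -
  obtain h :: "'a \<Rightarrow> nat" where h: "inj_on h (Field E)"
    using finite_imp_inj_to_nat_seg[OF finite_Field[OF E(1)]] by metis
  define P where "P = {(u, v) \<in> E. h u < h v}"
  have "h u \<noteq> h v" if "(u, v) \<in> E" for u v
    using that E(3) inj_onD[OF h] FieldI1[OF that] FieldI2[OF that] by (auto simp: irrefl_def)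
  then have E_eq: "E = P \<union> P\<inverse>"
    using E(2) by (auto simp: P_def linorder_neq_iff dest: symD)
  have asym: "(v, u) \<notin> P" if "(u, v) \<in> P" for u v
    using that by (auto simp: P_def)
  have finP: "finite P" using E(1) by (auto simp: P_def intro: finite_subset)
  have "card E = card P + card (P\<inverse>)"
    unfolding E_eq using finP asym by (intro card_Un_disjoint) auto
  then have card_E: "card E = 2 * card P" by simp
  have "bij_betw (\<lambda>D. D \<inter> P) (arc_orientations E) (Pow P)"
  proof (rule bij_betw_byWitness[where f' = "\<lambda>X. X \<union> (P - X)\<inverse>"])
    show "\<forall>D \<in> arc_orientations E. D \<inter> P \<union> (P - D \<inter> P)\<inverse> = D"
      unfolding arc_orientations_def E_eq by blast
    show "\<forall>X \<in> Pow P. (X \<union> (P - X)\<inverse>) \<inter> P = X"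
      using asym by blast
    show "(\<lambda>X. X \<union> (P - X)\<inverse>) ` Pow P \<subseteq> arc_orientations E"
      unfolding arc_orientations_def E_eq using asym by blast
  qed blast
  then have "card (arc_orientations E) = card (Pow P)" by (rule bij_betw_same_card)
  then show ?thesis using card_E finP by (simp add: card_Pow)
qed

lemma ex_topological_sorting:
  assumes "finite U" "acyclic (D \<inter> U \<times> U)"
  shows "\<exists>xs \<in> permutations_of_set U. sorted_wrt (\<lambda>u v. (v, u) \<notin> D) xs"
  using assms
proof (induction U rule: finite_psubset_induct)
  case (psubset U)
  show ?case
  proof (cases "U = {}")
    case False
    have "wf (D \<inter> U \<times> U)"
      using psubset by (intro finite_acyclic_wf) auto
    then obtain z where z: "z \<in> U" "\<And>y. (y, z) \<in> D \<inter> U \<times> U \<Longrightarrow> y \<notin> U"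
      using False wfE_min by (metis ex_in_conv)
    then have source: "\<forall>y \<in> U. (y, z) \<notin> D" by blast
    have "acyclic (D \<inter> (U - {z}) \<times> (U - {z}))"
      by (rule acyclic_subset[OF psubset.prems]) blast
    moreover have "U - {z} \<subset> U" using z(1) by blast
    ultimately have "\<exists>xs \<in> permutations_of_set (U - {z}). sorted_wrt (\<lambda>u v. (v, u) \<notin> D) xs"
      using psubset.IH[of "U - {z}"] by simp
    then obtain xs where xs: "set xs = U - {z}" "distinct xs" "sorted_wrt (\<lambda>u v. (v, u) \<notin> D) xs"
      unfolding permutations_of_set_def by blast
    have "z # xs \<in> permutations_of_set U"
      using xs(1,2) insert_Diff[OF z(1)] by (simp add: permutations_of_set_def)
    moreover have "sorted_wrt (\<lambda>u v. (v, u) \<notin> D) (z # xs)"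
      using xs(1,3) source by simp
    ultimately show ?thesis by blast
  qed simp
qed

lemma sorted_wrt_orientation_subset:
  assumes "irrefl E" "D \<in> arc_orientations E" "D' \<in> arc_orientations E"
    and "sorted_wrt (\<lambda>u v. (v, u) \<notin> D) xs" "sorted_wrt (\<lambda>u v. (v, u) \<notin> D') xs"
  shows "D \<inter> set xs \<times> set xs \<subseteq> D'"
proof (rule subrelI)
  fix u v assume "(u, v) \<in> D \<inter> set xs \<times> set xs"
  then obtain i j where ij: "u = xs ! i" "v = xs ! j" "i < length xs" "j < length xs"
    and D: "(u, v) \<in> D" by (auto simp: in_set_conv_nth)
  have E: "(u, v) \<in> E" using D assms(2) by (auto simp: arc_orientations_def)
  have "\<not> j < i" using assms(4) ij D by (auto simp: sorted_wrt_iff_nth_less)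
  moreover have "i \<noteq> j" using ij E assms(1) by (auto simp: irrefl_def)
  ultimately have "(v, u) \<notin> D'"
    using assms(5) ij by (auto simp: sorted_wrt_iff_nth_less)
  then show "(u, v) \<in> D'" using E assms(3) by (auto simp: arc_orientations_def)
qed

lemma card_sorted_orientations_le:
  assumes "finite E" "sym E" "irrefl E"
  shows "card {D \<in> arc_orientations E. sorted_wrt (\<lambda>u v. (v, u) \<notin> D) xs}
    \<le> 2 ^ (card (E - set xs \<times> set xs) div 2)"
proof -
  let ?E' = "E - set xs \<times> set xs"
  let ?S = "{D \<in> arc_orientations E. sorted_wrt (\<lambda>u v. (v, u) \<notin> D) xs}"
  have E': "finite ?E'" "sym ?E'" "irrefl ?E'"
    using assms by (auto simp: sym_def irrefl_def)
  have "inj_on (\<lambda>D. D - set xs \<times> set xs) ?S"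
  proof (rule inj_onI)
    fix D D' assume "D \<in> ?S" "D' \<in> ?S" and diff: "D - set xs \<times> set xs = D' - set xs \<times> set xs"
    then have "D \<inter> set xs \<times> set xs \<subseteq> D'" "D' \<inter> set xs \<times> set xs \<subseteq> D"
      using sorted_wrt_orientation_subset[OF assms(3)] by auto
    with diff show "D = D'" by blast
  qed
  moreover have "(\<lambda>D. D - set xs \<times> set xs) ` ?S \<subseteq> arc_orientations ?E'"
    by (auto simp: arc_orientations_def)
  ultimately have "card ?S \<le> card (arc_orientations ?E')"
    using finite_arc_orientations[OF E'(1)] by (rule card_inj_on_le)
  then show ?thesis by (simp add: card_arc_orientations[OF E'])
qed

lemma card_acyclic_orientations_le:
  assumes "finite E" "sym E" "irrefl E" "finite U"
  shows "card {D \<in> arc_orientations E. acyclic (D \<inter> U \<times> U)}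
    \<le> fact (card U) * 2 ^ (card (E - U \<times> U) div 2)"
proof -
  let ?sorted = "\<lambda>xs. {D \<in> arc_orientations E. sorted_wrt (\<lambda>u v. (v, u) \<notin> D) xs}"
  have "{D \<in> arc_orientations E. acyclic (D \<inter> U \<times> U)} \<subseteq> (\<Union>xs \<in> permutations_of_set U. ?sorted xs)"
    using ex_topological_sorting[OF assms(4)] by blast
  then have "card {D \<in> arc_orientations E. acyclic (D \<inter> U \<times> U)}
      \<le> card (\<Union>xs \<in> permutations_of_set U. ?sorted xs)"
    using finite_arc_orientations[OF assms(1)] by (intro card_mono) auto
  also have "\<dots> \<le> (\<Sum>xs \<in> permutations_of_set U. card (?sorted xs))"
    by (rule card_UN_le) simp
  also have "\<dots> \<le> (\<Sum>xs \<in> permutations_of_set U. 2 ^ (card (E - U \<times> U) div 2))"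
  proof (rule sum_mono)
    fix xs assume "xs \<in> permutations_of_set U"
    then show "card (?sorted xs) \<le> 2 ^ (card (E - U \<times> U) div 2)"
      using card_sorted_orientations_le[OF assms(1-3), of xs] by (simp add: permutations_of_setD)
  qed
  finally show ?thesis using assms(4) by simp
qed

lemma sum_nonempty_subsets_by_card:
  fixes f :: "nat \<Rightarrow> 'b::semiring_1"
  assumes "finite V"
  shows "(\<Sum>U \<in> Pow V - {{}}. f (card U)) = (\<Sum>u = 1..card V. of_nat (card V choose u) * f u)"
proof -
  have "card U \<in> {1..card V}" if "U \<in> Pow V - {{}}" for U
    using that assms card_mono[OF assms, of U] finite_subset[of U V]
    by (simp add: Suc_le_eq card_gt_0_iff)
  then have "(\<Sum>U \<in> Pow V - {{}}. f (card U))
      = (\<Sum>u = 1..card V. \<Sum>U \<in> {U \<in> Pow V - {{}}. card U = u}. f (card U))"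
    using assms by (intro sum.group[symmetric] image_subsetI) auto
  also have "\<dots> = (\<Sum>u = 1..card V. \<Sum>U \<in> {U. U \<subseteq> V \<and> card U = u}. f u)"
    by (intro sum.cong refl) auto
  also have "\<dots> = (\<Sum>u = 1..card V. of_nat (card V choose u) * f u)"
    by (simp only: sum_constant n_subsets[OF assms])
  finally show ?thesis .
qed

text \<open>A symmetric relation contains both arcs of every edge, so \<open>U\<close> spans at most \<open>d |U|\<close> edges.\<close>

definition sparse_on :: "('a \<times> 'a) set \<Rightarrow> nat \<Rightarrow> 'a set \<Rightarrow> bool" where
  "sparse_on E d F \<longleftrightarrow> (\<forall>U \<subseteq> F. card (E \<inter> U \<times> U) \<le> 2 * d * card U)"

lemma card_acyclic_orientations_dense_le:
  assumes E: "finite E" "sym E" "irrefl E" and U: "finite U" "2 * d * card U < card (E \<inter> U \<times> U)"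
  shows "real (card {D \<in> arc_orientations E. acyclic (D \<inter> U \<times> U)})
    \<le> fact (card U) / 2 ^ (d * card U) * 2 ^ (card E div 2)"
proof -
  have "card E = card (E \<inter> U \<times> U) + card (E - U \<times> U)"
    using E(1) by (simp add: card_Int_Diff)
  then have "card (E - U \<times> U) div 2 + d * card U \<le> card E div 2"
    using U(2) by linarith
  then have "(2::real) ^ (card (E - U \<times> U) div 2) * 2 ^ (d * card U) \<le> 2 ^ (card E div 2)"
    unfolding power_add[symmetric] by (rule power_increasing) simp
  then have "(2::real) ^ (card (E - U \<times> U) div 2) \<le> 2 ^ (card E div 2) / 2 ^ (d * card U)"
    by (simp add: pos_le_divide_eq)
  then have "fact (card U) * (2::real) ^ (card (E - U \<times> U) div 2)
      \<le> fact (card U) * (2 ^ (card E div 2) / 2 ^ (d * card U))"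
    by (rule mult_left_mono) simp
  moreover have "real (card {D \<in> arc_orientations E. acyclic (D \<inter> U \<times> U)})
      \<le> real (fact (card U) * 2 ^ (card (E - U \<times> U) div 2))"
    using card_acyclic_orientations_le[OF E U(1)] by (rule of_nat_mono)
  ultimately show ?thesis by simp
qed

lemma sum_binomial_fact_div_power_less_1:
  assumes "2 * N \<le> 2 ^ d"
  shows "(\<Sum>u = 1..N. real (N choose u) * (fact u / 2 ^ (d * u))) < 1"
proof -
  have half: "real N / 2 ^ d \<le> 1 / 2"
    using of_nat_mono[OF assms, where 'a = real] by (simp add: field_simps)
  have "real (N choose u) * (fact u / 2 ^ (d * u)) \<le> (1 / 2) ^ u" for u
  proof -
    have "real (N choose u) * fact u \<le> real N ^ u"
      using of_nat_mono[OF binomial_fact_pow, where 'a = real] by simp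
    then have "real (N choose u) * (fact u / 2 ^ (d * u)) \<le> (real N / 2 ^ d) ^ u"
      by (simp add: power_divide power_mult divide_right_mono)
    also have "\<dots> \<le> (1 / 2) ^ u" using half by (intro power_mono) auto
    finally show ?thesis .
  qed
  then have "(\<Sum>u = 1..N. real (N choose u) * (fact u / 2 ^ (d * u))) \<le> (\<Sum>u = 1..N. (1 / 2) ^ u)"
    by (rule sum_mono)
  also have "\<dots> = 1 - (1 / 2) ^ N" by (induction N) auto
  finally show ?thesis using zero_less_power[of "1 / 2 :: real" N] by linarith
qed

lemma ex_orientation_acyclic_sparse:
  assumes V: "finite V" and E: "E \<subseteq> V \<times> V" "sym E" "irrefl E" and d: "2 * card V \<le> 2 ^ d"
  shows "\<exists>D \<in> arc_orientations E. \<forall>F \<subseteq> V. acyclic (D \<inter> F \<times> F) \<longrightarrow> sparse_on E d F"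
proof -
  let ?acyclic = "\<lambda>U. {D \<in> arc_orientations E. acyclic (D \<inter> U \<times> U)}"
  let ?term = "\<lambda>u. fact u / 2 ^ (d * u) * 2 ^ (card E div 2) :: real"
  define dense where "dense = {U. U \<subseteq> V \<and> 2 * d * card U < card (E \<inter> U \<times> U)}"
  have finE: "finite E" using E(1) V by (meson finite_SigmaI finite_subset)
  have dense: "dense \<subseteq> Pow V - {{}}" by (auto simp: dense_def)
  then have fin_dense: "finite dense" using V finite_subset by blast
  have "real (card (\<Union>U \<in> dense. ?acyclic U)) \<le> (\<Sum>U \<in> dense. real (card (?acyclic U)))"
    using of_nat_mono[OF card_UN_le[OF fin_dense], where 'a = real] by simp
  also have "\<dots> \<le> (\<Sum>U \<in> dense. ?term (card U))"
    using V by (intro sum_mono card_acyclic_orientations_dense_le finE E)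
      (auto simp: dense_def intro: finite_subset)
  also have "\<dots> \<le> (\<Sum>U \<in> Pow V - {{}}. ?term (card U))"
    using V dense by (intro sum_mono2) auto
  also have "\<dots> = (\<Sum>u = 1..card V. real (card V choose u) * ?term u)"
    by (rule sum_nonempty_subsets_by_card[OF V])
  also have "\<dots> = (\<Sum>u = 1..card V. real (card V choose u) * (fact u / 2 ^ (d * u)))
      * 2 ^ (card E div 2)"
    by (simp add: sum_distrib_right mult.assoc)
  also have "\<dots> < 1 * 2 ^ (card E div 2)"
    by (intro mult_strict_right_mono sum_binomial_fact_div_power_less_1 d) simp
  also have "\<dots> = real (card (arc_orientations E))"
    by (simp add: card_arc_orientations[OF finE E(2,3)])
  finally have "card (\<Union>U \<in> dense. ?acyclic U) < card (arc_orientations E)" by simp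
  then have "\<not> arc_orientations E \<subseteq> (\<Union>U \<in> dense. ?acyclic U)"
    using fin_dense finite_arc_orientations[OF finE] by (auto dest!: card_mono[rotated])
  then obtain D where D: "D \<in> arc_orientations E" "\<And>U. U \<in> dense \<Longrightarrow> \<not> acyclic (D \<inter> U \<times> U)" by blast
  have "sparse_on E d F" if "F \<subseteq> V" "acyclic (D \<inter> F \<times> F)" for F
    unfolding sparse_on_def
  proof (intro allI impI)
    fix U assume "U \<subseteq> F"
    then have "acyclic (D \<inter> U \<times> U)" using that(2) by (blast intro: acyclic_subset)
    then show "card (E \<inter> U \<times> U) \<le> 2 * d * card U"
      using D(2)[of U] \<open>U \<subseteq> F\<close> that(1) by (force simp: dense_def)
  qed
  with D(1) show ?thesis by blast
qed

section \<open>Robust set families\<close>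

lemma card_nsets: "finite A \<Longrightarrow> card (nsets A k) = card A choose k"
  unfolding nsets_def by (simp add: n_subsets[symmetric]) (metis finite_subset)

definition avoiding :: "'a set set \<Rightarrow> 'a set \<Rightarrow> 'a set set" where
  "avoiding G S = {M \<in> G. M \<inter> S = {}}"

definition robust :: "nat \<Rightarrow> nat \<Rightarrow> 'a set set \<Rightarrow> bool" where
  "robust t m G \<longleftrightarrow> (\<forall>S. finite S \<longrightarrow> card S < t \<longrightarrow> m \<le> card (avoiding G S))"

lemma finite_avoiding: "finite G \<Longrightarrow> finite (avoiding G S)"
  by (simp add: avoiding_def)

lemma robust_0: "robust 0 m G"
  by (simp add: robust_def)

lemma robust_le_card:
  assumes "robust (Suc t) m G"
  shows "m \<le> card G"
  using assms[unfolded robust_def, rule_format, of "{}"] by (simp add: avoiding_def)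

lemma robust_avoiding:
  assumes "robust (Suc t) m G"
  shows "robust t m (avoiding G {x})"
  unfolding robust_def
proof (intro allI impI)
  fix S :: "'a set" assume "finite S" "card S < t"
  then have "m \<le> card (avoiding G (insert x S))"
    using assms by (simp add: robust_def card_insert_if)
  also have "avoiding G (insert x S) = avoiding (avoiding G {x}) S"
    by (auto simp: avoiding_def)
  finally show "m \<le> card (avoiding (avoiding G {x}) S)" .
qed

lemma robust_SucI:
  assumes "finite G" "G\<^sub>0 \<subseteq> G" "m \<le> card G\<^sub>0"
    and H: "\<And>x. x \<in> \<Union>G\<^sub>0 \<Longrightarrow> H x \<subseteq> avoiding G {x} \<and> robust t m (H x)"
  shows "robust (Suc t) m G"
  unfolding robust_def
proof (intro allI impI)
  fix S :: "'a set" assume S: "finite S" "card S < Suc t"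
  show "m \<le> card (avoiding G S)"
  proof (cases "S \<inter> \<Union>G\<^sub>0 = {}")
    case True
    then have "G\<^sub>0 \<subseteq> avoiding G S" using assms(2) by (auto simp: avoiding_def)
    then have "card G\<^sub>0 \<le> card (avoiding G S)"
      by (intro card_mono finite_avoiding assms(1))
    with assms(3) show ?thesis by linarith
  next
    case False
    then obtain x where x: "x \<in> S" "x \<in> \<Union>G\<^sub>0" by blast
    then have "card (S - {x}) < t" using S card_Suc_Diff1[OF S(1) x(1)] by simp
    then have "m \<le> card (avoiding (H x) (S - {x}))"
      using H[OF x(2)] S(1) by (auto simp: robust_def)
    also have "\<dots> \<le> card (avoiding G S)"
    proof (rule card_mono[OF finite_avoiding[OF assms(1)]])
      show "avoiding (H x) (S - {x}) \<subseteq> avoiding G S"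
        using H[OF x(2)] unfolding avoiding_def by blast
    qed
    finally show ?thesis .
  qed
qed

lemma ex_bounded_robust_subfamily:
  assumes "0 < k" "0 < m" "\<And>A. A \<in> F \<Longrightarrow> finite A \<and> card A \<le> k" "robust t m F"
  shows "\<exists>G \<subseteq> F. finite G \<and> card G \<le> (2 * k * m) ^ t \<and> robust t m G"
  using assms(3,4)
proof (induction t arbitrary: F)
  case 0
  show ?case by (intro exI[of _ "{}"]) (simp add: robust_0)
next
  case (Suc t)
  obtain G\<^sub>0 where G\<^sub>0: "G\<^sub>0 \<subseteq> F" "card G\<^sub>0 = m" "finite G\<^sub>0"
    using obtain_subset_with_card_n[OF robust_le_card[OF Suc.prems(2)]] .
  have "\<exists>H \<subseteq> avoiding F {x}. finite H \<and> card H \<le> (2 * k * m) ^ t \<and> robust t m H" for x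
    using Suc.prems(1) by (intro Suc.IH robust_avoiding[OF Suc.prems(2)]) (simp add: avoiding_def)
  then obtain H where H: "\<And>x. H x \<subseteq> avoiding F {x}" "\<And>x. finite (H x)"
    "\<And>x. card (H x) \<le> (2 * k * m) ^ t" "\<And>x. robust t m (H x)"
    by metis
  define G where "G = G\<^sub>0 \<union> (\<Union>x \<in> \<Union>G\<^sub>0. H x)"
  have finU: "finite (\<Union>G\<^sub>0)" using G\<^sub>0 Suc.prems(1) by blast
  have finG: "finite G" unfolding G_def using G\<^sub>0(3) H(2) finU by (intro finite_UnI finite_UN_I)
  have "card (\<Union>G\<^sub>0) \<le> (\<Sum>M \<in> G\<^sub>0. card M)" by (rule card_Union_le_sum_card)
  also have "\<dots> \<le> (\<Sum>M \<in> G\<^sub>0. k)" using G\<^sub>0(1) Suc.prems(1) by (intro sum_mono) auto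
  finally have card_Union: "card (\<Union>G\<^sub>0) \<le> m * k" using G\<^sub>0(2) by simp
  have "card (\<Union>x \<in> \<Union>G\<^sub>0. H x) \<le> (\<Sum>x \<in> \<Union>G\<^sub>0. card (H x))" by (rule card_UN_le[OF finU])
  also have "\<dots> \<le> (\<Sum>x \<in> \<Union>G\<^sub>0. (2 * k * m) ^ t)" by (intro sum_mono H)
  also have "\<dots> \<le> (m * k) * (2 * k * m) ^ t" using card_Union by simp
  finally have "card G \<le> m + (m * k) * (2 * k * m) ^ t"
    using card_Un_le[of G\<^sub>0 "\<Union>x \<in> \<Union>G\<^sub>0. H x"] G\<^sub>0(2) unfolding G_def by linarith
  also have "m * 1 \<le> m * (k * (2 * k * m) ^ t)"
    using assms(1,2) by (intro mult_left_mono) (auto simp: Suc_le_eq)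
  then have "m + (m * k) * (2 * k * m) ^ t \<le> (2 * k * m) ^ Suc t" by (simp add: algebra_simps)
  finally have "card G \<le> (2 * k * m) ^ Suc t" .
  moreover have "G \<subseteq> F" using G\<^sub>0(1) H(1) by (auto simp: G_def avoiding_def)
  moreover have "robust (Suc t) m G"
  proof (rule robust_SucI[OF finG])
    show "H x \<subseteq> avoiding G {x} \<and> robust t m (H x)" if "x \<in> \<Union>G\<^sub>0" for x
      using that H(1)[of x] H(4)[of x] by (auto simp: G_def avoiding_def)
  qed (use G\<^sub>0 in \<open>auto simp: G_def\<close>)
  ultimately show ?case using finG by blast
qed

lemma binomial_diff_diff_le:
  assumes "j \<le> k" "k \<le> n"
  shows "real ((n - j) choose (k - j)) \<le> (real k / real n) ^ j * real (n choose k)"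
  using assms(1)
proof (induction j)
  case (Suc j)
  let ?c = "\<lambda>j. real ((n - j) choose (k - j))"
  have "(n - j) * ((n - Suc j) choose (k - Suc j)) = (k - j) * ((n - j) choose (k - j))"
    using Suc.prems times_binomial_minus1_eq[of "k - j" "n - j"] by simp
  then have "real (n - j) * ?c (Suc j) = real (k - j) * ?c j"
    by (metis of_nat_mult)
  then have "?c (Suc j) = (real (k - j) / real (n - j)) * ?c j"
    using Suc.prems assms by (simp add: field_simps)
  also have "\<dots> \<le> (real k / real n) * ?c j"
  proof (rule mult_right_mono)
    have "real j * real k \<le> real j * real n" using assms by (intro mult_left_mono) auto
    then show "real (k - j) / real (n - j) \<le> real k / real n"
      using Suc.prems assms by (simp add: field_simps of_nat_diff)
  qed simp
  also have "\<dots> \<le> (real k / real n) * ((real k / real n) ^ j * real (n choose k))"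
    using Suc by (intro mult_left_mono) auto
  finally show ?case by simp
qed simp

lemma card_nsets_superset_le:
  assumes "finite X" "finite S"
  shows "real (card {A \<in> nsets X k. S \<subseteq> A})
    \<le> (real k / real (card X)) ^ card S * real (card X choose k)"
proof (cases "S \<subseteq> X \<and> card S \<le> k \<and> k \<le> card X")
  case False
  then have "{A \<in> nsets X k. S \<subseteq> A} = {}"
    using assms(1) by (auto simp: nsets_def dest: card_mono)
  then show ?thesis by (simp only: card.empty) simp
next
  case True
  have "inj_on (\<lambda>A. A - S) {A \<in> nsets X k. S \<subseteq> A}"
    by (rule inj_onI) blast
  moreover have "(\<lambda>A. A - S) ` {A \<in> nsets X k. S \<subseteq> A} \<subseteq> nsets (X - S) (k - card S)"
    using assms(2) by (auto simp: nsets_def card_Diff_subset)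
  ultimately have "card {A \<in> nsets X k. S \<subseteq> A} \<le> card (nsets (X - S) (k - card S))"
    using assms(1) by (intro card_inj_on_le finite_imp_finite_nsets) auto
  also have "\<dots> = (card X - card S) choose (k - card S)"
    using assms True by (simp add: card_nsets card_Diff_subset)
  finally have "real (card {A \<in> nsets X k. S \<subseteq> A}) \<le> real ((card X - card S) choose (k - card S))"
    by simp
  also have "\<dots> \<le> (real k / real (card X)) ^ card S * real (card X choose k)"
    using True by (intro binomial_diff_diff_le) auto
  finally show ?thesis .
qed

lemma card_meeting_le:
  fixes b :: real
  assumes "finite \<A>" "finite M" "\<And>x. x \<in> M \<Longrightarrow> real (card {A \<in> \<A>. x \<in> A}) \<le> b"
  shows "real (card {A \<in> \<A>. A \<inter> M \<noteq> {}}) \<le> real (card M) * b"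
proof -
  have "{A \<in> \<A>. A \<inter> M \<noteq> {}} = (\<Union>x \<in> M. {A \<in> \<A>. x \<in> A})" by blast
  then have "card {A \<in> \<A>. A \<inter> M \<noteq> {}} \<le> (\<Sum>x \<in> M. card {A \<in> \<A>. x \<in> A})"
    using card_UN_le[OF assms(2)] by metis
  then have "real (card {A \<in> \<A>. A \<inter> M \<noteq> {}}) \<le> (\<Sum>x \<in> M. real (card {A \<in> \<A>. x \<in> A}))"
    by (simp flip: of_nat_sum)
  also have "\<dots> \<le> (\<Sum>x \<in> M. b)" by (intro sum_mono assms(3))
  finally show ?thesis by simp
qed

lemma card_nsets_meeting_le:
  assumes "finite X" "finite S"
  shows "real (card {A \<in> nsets X k. A \<inter> S \<noteq> {}})
    \<le> real (card S) * (real k / real (card X)) * real (card X choose k)"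
proof -
  have "real (card {A \<in> nsets X k. x \<in> A}) \<le> real k / real (card X) * real (card X choose k)" for x
    using card_nsets_superset_le[OF assms(1), of "{x}" k] by simp
  then show ?thesis
    unfolding mult.assoc using assms by (intro card_meeting_le finite_imp_finite_nsets) auto
qed

text \<open>Double counting: some member of \<open>G\<close> meets at least half of \<open>\<A>\<close>.\<close>

lemma card_meeting_half_le:
  fixes b :: real
  assumes "finite \<A>" "finite G" "G \<noteq> {}" "0 \<le> b"
    and M: "\<And>M. M \<in> G \<Longrightarrow> finite M \<and> card M \<le> k"
    and half: "\<And>A. A \<in> \<A> \<Longrightarrow> card G \<le> 2 * card {M \<in> G. A \<inter> M \<noteq> {}}"
    and b: "\<And>x. x \<in> \<Union>G \<Longrightarrow> real (card {A \<in> \<A>. x \<in> A}) \<le> b"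
  shows "real (card \<A>) \<le> 2 * real k * b"
proof -
  have meet: "real (card {A \<in> \<A>. A \<inter> M \<noteq> {}}) \<le> real k * b" if "M \<in> G" for M
  proof -
    have "real (card {A \<in> \<A>. A \<inter> M \<noteq> {}}) \<le> real (card M) * b"
      using that assms(1) M b by (intro card_meeting_le) auto
    also have "\<dots> \<le> real k * b" using M[OF that] assms(4) by (intro mult_right_mono) auto
    finally show ?thesis .
  qed
  have "card G * card \<A> = (\<Sum>A \<in> \<A>. card G)" by simp
  also have "\<dots> \<le> (\<Sum>A \<in> \<A>. 2 * card {M \<in> G. A \<inter> M \<noteq> {}})" by (intro sum_mono half)
  also have "\<dots> = 2 * (\<Sum>M \<in> G. card {A \<in> \<A>. A \<inter> M \<noteq> {}})"
    unfolding sum_distrib_left[symmetric]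
    by (intro arg_cong[where f = "(*) 2"] sum_multicount_gen) (use assms(1,2) in auto)
  finally have "real (card G * card \<A>) \<le> real (2 * (\<Sum>M \<in> G. card {A \<in> \<A>. A \<inter> M \<noteq> {}}))"
    by (rule of_nat_mono)
  also have "\<dots> = 2 * (\<Sum>M \<in> G. real (card {A \<in> \<A>. A \<inter> M \<noteq> {}}))" by simp
  also have "\<dots> \<le> 2 * (\<Sum>M \<in> G. real k * b)" using meet by (intro mult_left_mono sum_mono) auto
  finally have "real (card G) * real (card \<A>) \<le> real (card G) * (2 * real k * b)" by simp
  moreover have "0 < real (card G)" using assms(2,3) by (simp add: card_gt_0_iff)
  ultimately show ?thesis by (simp only: mult_le_cancel_left_pos)
qed

definition nearly_intersecting :: "'a set \<Rightarrow> nat \<Rightarrow> nat \<Rightarrow> 'a set set \<Rightarrow> 'a set set" where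
  "nearly_intersecting X k j G = {A \<in> nsets X k. card (avoiding G A) \<le> j}"

lemma card_avoiding_le_twice_meeting:
  assumes "finite G" "card (avoiding G A) \<le> j" "2 * j \<le> card (avoiding G S)"
  shows "card (avoiding G S) \<le> 2 * card {M \<in> avoiding G S. A \<inter> M \<noteq> {}}"
proof -
  let ?G = "avoiding G S"
  have "card ?G = card (?G \<inter> {M. A \<inter> M = {}}) + card (?G - {M. A \<inter> M = {}})"
    by (rule card_Int_Diff[OF finite_avoiding[OF assms(1)]])
  moreover have "card (?G - {M. A \<inter> M = {}}) = card {M \<in> ?G. A \<inter> M \<noteq> {}}"
    by (rule arg_cong[where f = card]) blast
  moreover have "card (?G \<inter> {M. A \<inter> M = {}}) \<le> card (avoiding G A)"
    by (rule card_mono[OF finite_avoiding[OF assms(1)]]) (auto simp: avoiding_def)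
  ultimately show ?thesis using assms(2,3) by linarith
qed

lemma card_nearly_intersecting_above_le:
  fixes X :: "'a set" and k t :: nat
  defines "b \<equiv> (real k / real (card X)) ^ t * real (card X choose k)"
  assumes X: "finite X" and j: "0 < j" and G: "finite G" "robust t (2 * j) G"
    "\<And>M. M \<in> G \<Longrightarrow> finite M \<and> card M \<le> k"
    and S: "finite S" "card S + i = t"
  shows "real (card {A \<in> nearly_intersecting X k j G. S \<subseteq> A}) \<le> (2 * real k) ^ i * b"
  using S
proof (induction i arbitrary: S)
  case 0
  have "real (card {A \<in> nearly_intersecting X k j G. S \<subseteq> A}) \<le> real (card {A \<in> nsets X k. S \<subseteq> A})"
    using X by (intro of_nat_mono card_mono)
      (auto simp: nearly_intersecting_def finite_imp_finite_nsets)
  also have "\<dots> \<le> b"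
    using card_nsets_superset_le[OF X 0(1), of k] 0 by (simp add: b_def)
  finally show ?case by simp
next
  case (Suc i)
  let ?\<A> = "{A \<in> nearly_intersecting X k j G. S \<subseteq> A}" and ?G = "avoiding G S"
  have many: "2 * j \<le> card ?G" using G(2) Suc.prems by (simp add: robust_def)
  have "real (card ?\<A>) \<le> 2 * real k * ((2 * real k) ^ i * b)"
  proof (rule card_meeting_half_le[OF _ finite_avoiding[OF G(1)]])
    show "finite ?\<A>" using X by (simp add: nearly_intersecting_def finite_imp_finite_nsets)
    show "?G \<noteq> {}" using many j by auto
    show "0 \<le> (2 * real k) ^ i * b" by (simp add: b_def)
    show "finite M \<and> card M \<le> k" if "M \<in> ?G" for M using that G(3) by (simp add: avoiding_def)
    show "card ?G \<le> 2 * card {M \<in> ?G. A \<inter> M \<noteq> {}}" if "A \<in> ?\<A>" for A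
      using that many by (intro card_avoiding_le_twice_meeting[OF G(1)])
        (auto simp: nearly_intersecting_def)
    fix x assume "x \<in> \<Union>?G"
    then have "x \<notin> S" by (auto simp: avoiding_def)
    then have "real (card {A \<in> nearly_intersecting X k j G. insert x S \<subseteq> A}) \<le> (2 * real k) ^ i * b"
      using Suc by (intro Suc.IH) simp_all
    moreover have "{A \<in> ?\<A>. x \<in> A} = {A \<in> nearly_intersecting X k j G. insert x S \<subseteq> A}" by auto
    ultimately show "real (card {A \<in> ?\<A>. x \<in> A}) \<le> (2 * real k) ^ i * b" by (simp only:)
  qed
  then show ?case by simp
qed

lemma card_nearly_intersecting_le:
  assumes "finite X" "0 < j" "finite G" "robust t (2 * j) G"
    "\<And>M. M \<in> G \<Longrightarrow> finite M \<and> card M \<le> k"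
  shows "real (card (nearly_intersecting X k j G))
    \<le> (2 * (real k)\<^sup>2 / real (card X)) ^ t * real (card X choose k)"
proof -
  have "real (card (nearly_intersecting X k j G))
      \<le> (2 * real k) ^ t * ((real k / real (card X)) ^ t * real (card X choose k))"
    using card_nearly_intersecting_above_le[OF assms, of "{}" t] by simp
  also have "\<dots> = (2 * (real k)\<^sup>2 / real (card X)) ^ t * real (card X choose k)"
    by (simp add: power2_eq_square power_mult_distrib power_divide power_mult)
  finally show ?thesis .
qed

section \<open>Containers\<close>

lemma card_high_degree_le:
  assumes F: "finite F" "G \<subseteq> F" and E: "sym E" "sparse_on E d F"
  shows "card {A \<in> F - G. 2 * d < card {M \<in> G. (A, M) \<in> E}} \<le> card G"
proof -
  define Y where "Y = {A \<in> F - G. 2 * d < card {M \<in> G. (A, M) \<in> E}}"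
  have fin: "finite G" "finite Y" using F finite_subset unfolding Y_def by auto
  define W where "W = (SIGMA A:Y. {M \<in> G. (A, M) \<in> E})"
  have finW: "finite W" using fin by (auto simp: W_def)
  have "card Y * (2 * d + 1) = (\<Sum>A \<in> Y. 2 * d + 1)" by simp
  also have "\<dots> \<le> (\<Sum>A \<in> Y. card {M \<in> G. (A, M) \<in> E})"
    by (intro sum_mono) (auto simp: Y_def)
  also have "\<dots> = card W" using fin by (simp add: W_def)
  finally have W: "card Y * (2 * d + 1) \<le> card W" .
  have "2 * card W = card W + card (W\<inverse>)" by simp
  also have "\<dots> = card (W \<union> W\<inverse>)"
    by (rule card_Un_disjoint[symmetric]) (use finW in \<open>auto simp: W_def Y_def\<close>)
  also have "\<dots> \<le> card (E \<inter> (G \<union> Y) \<times> (G \<union> Y))"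
    using fin E(1) by (intro card_mono) (auto simp: W_def sym_def)
  also have "\<dots> \<le> 2 * d * card (G \<union> Y)"
    using E(2) F(2) by (simp add: sparse_on_def Y_def)
  also have "\<dots> \<le> 2 * d * (card G + card Y)"
    by (intro mult_le_mono2 card_Un_le)
  finally have "(d + 1) * card Y \<le> d * card G" using W by (simp add: algebra_simps)
  also have "\<dots> \<le> (d + 1) * card G" by simp
  finally show ?thesis unfolding Y_def by (simp only: mult_le_cancel1)
qed

definition small_subsets :: "'a set \<Rightarrow> nat \<Rightarrow> 'a set set" where
  "small_subsets X j = {S. S \<subseteq> X \<and> card S \<le> j}"

lemma finite_small_subsets: "finite X \<Longrightarrow> finite (small_subsets X j)"
  by (simp add: small_subsets_def)

lemma card_small_subsets_le:
  assumes "finite X"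
  shows "card (small_subsets X j) \<le> (card X + 1) ^ j"
proof -
  have "small_subsets X j = (\<Union>i \<in> {..j}. nsets X i)"
    using assms by (auto simp: small_subsets_def nsets_def intro: finite_subset)
  then have "card (small_subsets X j) \<le> (\<Sum>i \<le> j. card (nsets X i))"
    by (simp only: card_UN_le finite_atMost)
  also have "\<dots> \<le> (\<Sum>i \<le> j. (j choose i) * card X ^ i)"
  proof (rule sum_mono)
    fix i assume "i \<in> {..j}"
    moreover have "card X choose i \<le> card X ^ i"
      by (cases "i \<le> card X") (simp_all add: binomial_le_pow binomial_eq_0)
    ultimately have "1 * (card X choose i) \<le> (j choose i) * card X ^ i"
      by (intro mult_le_mono) (simp_all add: Suc_le_eq)
    then show "card (nsets X i) \<le> (j choose i) * card X ^ i" using assms by (simp add: card_nsets)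
  qed
  also have "\<dots> = (card X + 1) ^ j" unfolding binomial by simp
  finally show ?thesis .
qed

definition container_cores :: "'a set \<Rightarrow> nat \<Rightarrow> nat \<Rightarrow> nat \<Rightarrow> nat \<Rightarrow> 'a set set set" where
  "container_cores X k d t g =
    (\<lambda>S. {A \<in> nsets X k. A \<inter> S \<noteq> {}}) ` small_subsets X t \<union>
    nearly_intersecting X k (2 * d) ` {G \<in> small_subsets (nsets X k) g. robust t (4 * d) G}"

definition containers :: "'a set \<Rightarrow> nat \<Rightarrow> nat \<Rightarrow> nat \<Rightarrow> nat \<Rightarrow> 'a set set set" where
  "containers X k d t g =
    (\<lambda>(C, Y). C \<union> Y) ` (container_cores X k d t g \<times> small_subsets (nsets X k) (2 * g))"

lemma containers_subset_nsets:
  assumes "K \<in> containers X k d t g"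
  shows "K \<subseteq> nsets X k"
  using assms
  by (auto simp: containers_def container_cores_def nearly_intersecting_def small_subsets_def)

lemma finite_container_cores:
  assumes "finite X"
  shows "finite (container_cores X k d t g)"
  using assms by (simp add: container_cores_def finite_small_subsets finite_imp_finite_nsets)

lemma finite_containers:
  assumes "finite X"
  shows "finite (containers X k d t g)"
  using assms
  by (simp add: containers_def finite_container_cores finite_small_subsets finite_imp_finite_nsets)

definition container_count_bound :: "nat \<Rightarrow> nat \<Rightarrow> nat \<Rightarrow> nat \<Rightarrow> nat" where
  "container_count_bound n k t g =
    ((n + 1) ^ t + ((n choose k) + 1) ^ g) * ((n choose k) + 1) ^ (2 * g)"

lemma card_containers_le:
  assumes "finite X"
  shows "card (containers X k d t g) \<le> container_count_bound (card X) k t g"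
proof -
  let ?V = "nsets X k" and ?robust = "{G \<in> small_subsets (nsets X k) g. robust t (4 * d) G}"
  have finV: "finite ?V" and cardV: "card ?V = card X choose k"
    using assms by (simp_all add: finite_imp_finite_nsets card_nsets)
  have "card (container_cores X k d t g) \<le> card (small_subsets X t) + card ?robust"
    unfolding container_cores_def using assms finV
    by (intro order_trans[OF card_Un_le] add_mono card_image_le) (auto simp: finite_small_subsets)
  also have "\<dots> \<le> card (small_subsets X t) + card (small_subsets ?V g)"
    using finV by (intro add_left_mono card_mono) (auto simp: finite_small_subsets)
  also have "\<dots> \<le> (card X + 1) ^ t + ((card X choose k) + 1) ^ g"
    using card_small_subsets_le[OF finV] unfolding cardV
    by (intro add_mono card_small_subsets_le assms)
  finally have cores: "card (container_cores X k d t g)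
      \<le> (card X + 1) ^ t + ((card X choose k) + 1) ^ g" .
  have "card (containers X k d t g)
      \<le> card (container_cores X k d t g) * card (small_subsets ?V (2 * g))"
    unfolding containers_def card_cartesian_product[symmetric] using assms finV
    by (intro card_image_le finite_cartesian_product finite_container_cores finite_small_subsets)
  also have "\<dots> \<le> container_count_bound (card X) k t g"
    unfolding container_count_bound_def
    using cores card_small_subsets_le[OF finV] unfolding cardV by (intro mult_le_mono)
  finally show ?thesis .
qed

lemma ln_card_containers_le:
  assumes "finite X"
  shows "ln (real (card (containers X k d t g))) \<le> ln (real (container_count_bound (card X) k t g))"
proof -
  have "0 < container_count_bound (card X) k t g" by (simp add: container_count_bound_def)
  then show ?thesis
    using card_containers_le[OF assms, of k d t g] by (cases "card (containers X k d t g) = 0") auto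
qed

definition core_density :: "nat \<Rightarrow> nat \<Rightarrow> nat \<Rightarrow> real" where
  "core_density n k t = max (real t * (real k / real n)) ((2 * (real k)\<^sup>2 / real n) ^ t)"

lemma card_container_core_le:
  assumes "finite X" "0 < d" "C \<in> container_cores X k d t g"
  shows "real (card C) \<le> core_density (card X) k t * real (card X choose k)"
  using assms(3) unfolding container_cores_def
proof (elim UnE imageE)
  fix S assume C: "C = {A \<in> nsets X k. A \<inter> S \<noteq> {}}" and S: "S \<in> small_subsets X t"
  then have "finite S" using assms(1) finite_subset by (auto simp: small_subsets_def)
  then have "real (card C) \<le> real (card S) * (real k / real (card X)) * real (card X choose k)"
    unfolding C by (rule card_nsets_meeting_le[OF assms(1)])
  also have "\<dots> \<le> real t * (real k / real (card X)) * real (card X choose k)"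
    using S by (intro mult_right_mono) (auto simp: small_subsets_def)
  also have "\<dots> \<le> core_density (card X) k t * real (card X choose k)"
    by (intro mult_right_mono) (auto simp: core_density_def)
  finally show ?thesis .
next
  fix G assume C: "C = nearly_intersecting X k (2 * d) G"
    and "G \<in> {G \<in> small_subsets (nsets X k) g. robust t (4 * d) G}"
  then have G: "G \<subseteq> nsets X k" "robust t (2 * (2 * d)) G" by (auto simp: small_subsets_def)
  then have "finite G" using assms(1) finite_imp_finite_nsets finite_subset by metis
  then have "real (card C) \<le> (2 * (real k)\<^sup>2 / real (card X)) ^ t * real (card X choose k)"
    unfolding C using assms G
    by (intro card_nearly_intersecting_le) (auto simp: nsets_def)
  also have "\<dots> \<le> core_density (card X) k t * real (card X choose k)"
    by (intro mult_right_mono) (auto simp: core_density_def)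
  finally show ?thesis .
qed

lemma card_container_le:
  assumes "finite X" "0 < d" "K \<in> containers X k d t g"
  shows "real (card K) \<le> core_density (card X) k t * real (card X choose k) + 2 * real g"
proof -
  obtain C Y where K: "K = C \<union> Y" "C \<in> container_cores X k d t g" "card Y \<le> 2 * g"
    using assms(3) by (auto simp: containers_def small_subsets_def)
  have "real (card K) \<le> real (card C) + 2 * real g"
    using card_Un_le[of C Y] K(1,3) by simp
  with card_container_core_le[OF assms(1,2) K(2)] show ?thesis by linarith
qed

lemma ex_container_if_not_robust:
  assumes F: "F \<subseteq> nsets X k" "\<not> robust t (4 * d) F" and g: "4 * d \<le> 2 * g"
  shows "\<exists>K \<in> containers X k d t g. F \<subseteq> K"
proof -
  obtain S where S: "finite S" "card S < t" "card (avoiding F S) < 4 * d"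
    using F(2) by (auto simp: robust_def not_le)
  have "card (S \<inter> X) \<le> card S" using S(1) by (intro card_mono) auto
  then have "S \<inter> X \<in> small_subsets X t" using S(2) by (auto simp: small_subsets_def)
  then have "{A \<in> nsets X k. A \<inter> (S \<inter> X) \<noteq> {}} \<in> container_cores X k d t g"
    unfolding container_cores_def by blast
  moreover have "avoiding F S \<in> small_subsets (nsets X k) (2 * g)"
    using S(3) g F(1) by (auto simp: small_subsets_def avoiding_def)
  ultimately have "{A \<in> nsets X k. A \<inter> (S \<inter> X) \<noteq> {}} \<union> avoiding F S \<in> containers X k d t g"
    unfolding containers_def by auto
  moreover have "F \<subseteq> {A \<in> nsets X k. A \<inter> (S \<inter> X) \<noteq> {}} \<union> avoiding F S"
    using F(1) unfolding avoiding_def nsets_def by blast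
  ultimately show ?thesis by blast
qed

lemma ex_container_if_robust:
  assumes X: "finite X" and k: "0 < k" and d: "0 < d" and g: "(8 * k * d) ^ t \<le> g"
    and F: "F \<subseteq> nsets X k" "robust t (4 * d) F" "sparse_on {(A, B). A \<inter> B = {}} d F"
  shows "\<exists>K \<in> containers X k d t g. F \<subseteq> K"
proof -
  let ?E = "{(A, B). A \<inter> B = {}}"
  have "\<exists>G \<subseteq> F. finite G \<and> card G \<le> (2 * k * (4 * d)) ^ t \<and> robust t (4 * d) G"
    using k d F(1,2) by (intro ex_bounded_robust_subfamily) (auto simp: nsets_def)
  then obtain G where G: "G \<subseteq> F" "finite G" "card G \<le> g" "robust t (4 * d) G"
    using g by (auto simp: mult.assoc)
  define Y where "Y = {A \<in> F - G. 2 * d < card {M \<in> G. (A, M) \<in> ?E}}"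
  have "finite F" using F(1) X finite_imp_finite_nsets finite_subset by metis
  then have "card Y \<le> card G"
    unfolding Y_def by (intro card_high_degree_le G(1) F(3)) (auto simp: sym_def)
  then have "card (G \<union> Y) \<le> 2 * g" using card_Un_le[of G Y] G(3) by linarith
  then have "G \<union> Y \<in> small_subsets (nsets X k) (2 * g)"
    using G(1) F(1) by (auto simp: small_subsets_def Y_def)
  moreover have "nearly_intersecting X k (2 * d) G \<in> container_cores X k d t g"
    using G F(1) by (auto simp: container_cores_def small_subsets_def)
  ultimately have "nearly_intersecting X k (2 * d) G \<union> (G \<union> Y) \<in> containers X k d t g"
    unfolding containers_def by auto
  moreover have "{M \<in> G. (A, M) \<in> ?E} = avoiding G A" for A
    by (auto simp: avoiding_def)
  then have "F \<subseteq> nearly_intersecting X k (2 * d) G \<union> (G \<union> Y)"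
    using F(1) by (auto simp: nearly_intersecting_def Y_def)
  ultimately show ?thesis by blast
qed

lemma ex_container:
  assumes "finite X" "0 < k" "0 < d" "0 < t" "(8 * k * d) ^ t \<le> g"
    and "F \<subseteq> nsets X k" "sparse_on {(A, B). A \<inter> B = {}} d F"
  shows "\<exists>K \<in> containers X k d t g. F \<subseteq> K"
proof (cases "robust t (4 * d) F")
  case True
  then show ?thesis using assms by (intro ex_container_if_robust)
next
  case False
  have "4 * d \<le> (8 * k * d) ^ 1" using assms(2) by simp
  also have "\<dots> \<le> (8 * k * d) ^ t" using assms(2-4) by (intro power_increasing) auto
  finally show ?thesis using assms False by (intro ex_container_if_not_robust) auto
qed

section \<open>Random lists\<close>

lemma binomial_mult_2_le:
  assumes "3 * s \<le> 2 * r"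
  shows "(2 * r) choose r \<le> 4 ^ s * ((2 * r - s) choose r)"
  using assms
proof (induction s)
  case (Suc s)
  let ?n = "2 * r - s"
  have n: "0 < ?n" "?n \<le> 4 * (?n - r)" using Suc.prems by auto
  have "?n * (?n choose r) \<le> 4 * (?n - r) * (?n choose r)"
    using n(2) by (rule mult_right_mono) simp
  also have "\<dots> = ?n * (4 * ((?n - 1) choose r))"
    using binomial_absorb_comp[of ?n r] by simp
  finally have "?n choose r \<le> 4 * ((2 * r - Suc s) choose r)"
    using n(1) by simp
  then have "4 ^ s * (?n choose r) \<le> 4 ^ s * (4 * ((2 * r - Suc s) choose r))"
    by (rule mult_le_mono2)
  moreover have "(2 * r) choose r \<le> 4 ^ s * (?n choose r)" using Suc by simp
  ultimately show ?case by (simp only: power_Suc2 mult.assoc)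
qed simp

lemma card_nsets_meeting_small_le:
  assumes P: "finite P" "card P = 2 * r" and T: "T \<subseteq> P" "card T \<le> s" and s: "3 * s \<le> 2 * r"
  shows "real (card {B \<in> nsets P r. B \<inter> T \<noteq> {}}) \<le> (1 - 1 / 4 ^ s) * real ((2 * r) choose r)"
proof -
  let ?meet = "{B \<in> nsets P r. B \<inter> T \<noteq> {}}"
  have "card (?meet \<union> nsets (P - T) r) = card ?meet + card (nsets (P - T) r)"
    using P(1) finite_imp_finite_nsets by (intro card_Un_disjoint) (auto simp: nsets_def)
  moreover have "?meet \<union> nsets (P - T) r = nsets P r"
    by (auto simp: nsets_def)
  moreover have "card (P - T) = 2 * r - card T"
    using P T(1) finite_subset by (metis card_Diff_subset)
  ultimately have "(2 * r) choose r = card ?meet + ((2 * r - card T) choose r)"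
    using P by (simp add: card_nsets)
  moreover have "(2 * r - s) choose r \<le> (2 * r - card T) choose r"
    using T(2) by (intro binomial_right_mono) simp
  ultimately have "real (card ?meet) \<le> real ((2 * r) choose r) - real ((2 * r - s) choose r)"
    by linarith
  moreover have "real ((2 * r) choose r) / 4 ^ s \<le> real ((2 * r - s) choose r)"
    using of_nat_mono[OF binomial_mult_2_le[OF s], where 'a = real] by (simp add: field_simps)
  ultimately show ?thesis by (simp add: left_diff_distrib)
qed

lemma card_le_twice_card_few_colours:
  fixes K :: "'c \<Rightarrow> 'a set"
  assumes V: "finite V" and P: "finite P"
    and K: "\<And>c. c \<in> P \<Longrightarrow> K c \<subseteq> V" "\<And>c. c \<in> P \<Longrightarrow> real (card (K c)) \<le> \<beta> * real (card V)"
    and s: "2 * real (card P) * \<beta> \<le> real s + 1"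
  shows "card V \<le> 2 * card {v \<in> V. card {c \<in> P. v \<in> K c} \<le> s}"
proof -
  let ?deg = "\<lambda>v. card {c \<in> P. v \<in> K c}"
  define H where "H = {v \<in> V. ?deg v \<le> s}"
  have H: "H \<subseteq> V" by (auto simp: H_def)
  have "card (V - H) * (s + 1) = (\<Sum>v \<in> V - H. s + 1)" by simp
  also have "\<dots> \<le> (\<Sum>v \<in> V - H. ?deg v)" by (intro sum_mono) (auto simp: H_def)
  also have "\<dots> \<le> (\<Sum>v \<in> V. ?deg v)" using V by (intro sum_mono2) auto
  also have "\<dots> = (\<Sum>c \<in> P. card {v \<in> V. v \<in> K c})"
    by (rule sum_multicount_gen) (use V P in auto)
  also have "\<dots> = (\<Sum>c \<in> P. card (K c))"
    using K(1) by (intro sum.cong refl arg_cong[where f = card]) blast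
  finally have "real (card (V - H) * (s + 1)) \<le> real (\<Sum>c \<in> P. card (K c))" by (rule of_nat_mono)
  also have "\<dots> \<le> (\<Sum>c \<in> P. \<beta> * real (card V))" unfolding of_nat_sum by (intro sum_mono K(2))
  also have "\<dots> = (2 * real (card P) * \<beta>) * real (card V) / 2" by simp
  also have "\<dots> \<le> (real s + 1) * real (card V) / 2"
    using s by (intro divide_right_mono mult_right_mono) auto
  finally have "(real s + 1) * (2 * real (card (V - H))) \<le> (real s + 1) * real (card V)"
    by (simp add: algebra_simps)
  then have "2 * real (card (V - H)) \<le> real (card V)" by (simp only: mult_le_cancel_left)
  moreover have "card V = card H + card (V - H)"
    using V H by (metis card_Int_Diff inf.absorb_iff2)
  ultimately show ?thesis by (simp add: H_def)
qed

definition lists_meeting :: "nat set \<Rightarrow> nat \<Rightarrow> (nat \<Rightarrow> 'a set) \<Rightarrow> 'a \<Rightarrow> nat set set" where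
  "lists_meeting P r K v = {B \<in> nsets P r. \<exists>c \<in> B. v \<in> K c}"

lemma card_lists_meeting_le:
  assumes P: "finite P" "card P = 2 * r" and s: "3 * s \<le> 2 * r"
  shows "real (card (lists_meeting P r K v))
    \<le> real ((2 * r) choose r) * (if card {c \<in> P. v \<in> K c} \<le> s then 1 - 1 / 4 ^ s else 1)"
proof (cases "card {c \<in> P. v \<in> K c} \<le> s")
  case True
  have "lists_meeting P r K v = {B \<in> nsets P r. B \<inter> {c \<in> P. v \<in> K c} \<noteq> {}}"
    by (auto simp: lists_meeting_def nsets_def)
  then have "real (card (lists_meeting P r K v)) \<le> (1 - 1 / 4 ^ s) * real ((2 * r) choose r)"
    using card_nsets_meeting_small_le[OF P _ True s] by auto
  with True show ?thesis by (simp add: mult.commute)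
next
  case False
  have "card (lists_meeting P r K v) \<le> card (nsets P r)"
    using P(1) by (intro card_mono finite_imp_finite_nsets) (auto simp: lists_meeting_def)
  then show ?thesis using P False by (simp add: card_nsets)
qed

lemma card_PiE_lists_meeting_le:
  assumes V: "finite V" and P: "finite P" "card P = 2 * r"
    and K: "\<And>c. c \<in> P \<Longrightarrow> K c \<subseteq> V" "\<And>c. c \<in> P \<Longrightarrow> real (card (K c)) \<le> \<beta> * real (card V)"
    and s: "3 * s \<le> 2 * r" "4 * real r * \<beta> \<le> real s + 1"
  shows "real (card (PiE V (lists_meeting P r K)))
    \<le> real ((2 * r) choose r) ^ card V * exp (- (real (card V) / (2 * 4 ^ s)))"
proof -
  let ?C = "real ((2 * r) choose r)" and ?few = "\<lambda>v. card {c \<in> P. v \<in> K c} \<le> s"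
  define q :: real where "q = 1 / 4 ^ s"
  define H where "H = {v \<in> V. ?few v}"
  have q: "0 \<le> q" "q \<le> 1" by (auto simp: q_def)
  have "card V \<le> 2 * card H"
    unfolding H_def using s(2) P(2) by (intro card_le_twice_card_few_colours[OF V P(1) K]) auto
  then have half: "q * (real (card V) / 2) \<le> q * real (card H)"
    using q by (intro mult_left_mono) auto
  have "(\<Prod>v \<in> V. real (card (lists_meeting P r K v)))
      \<le> (\<Prod>v \<in> V. ?C * (if ?few v then 1 - q else 1))"
    unfolding q_def by (intro prod_mono conjI card_lists_meeting_le P s(1)) simp
  also have "\<dots> = ?C ^ card V * (1 - q) ^ card H"
    using V by (simp add: prod.distrib prod.If_cases H_def Int_def)
  also have "\<dots> \<le> ?C ^ card V * exp (- q) ^ card H"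
    using q exp_ge_add_one_self[of "- q"] by (intro mult_left_mono power_mono) auto
  also have "exp (- q) ^ card H = exp (- (q * real (card H)))"
    by (simp flip: exp_of_nat_mult add: mult.commute)
  also have "?C ^ card V * \<dots> \<le> ?C ^ card V * exp (- (q * (real (card V) / 2)))"
    using half by (intro mult_left_mono) auto
  finally show ?thesis using V by (simp add: card_PiE q_def mult.commute)
qed

lemma ex_lists_avoiding_containers:
  assumes V: "finite V" and P: "finite P" "card P = 2 * r"
    and \<K>: "finite \<K>" "\<And>K. K \<in> \<K> \<Longrightarrow> K \<subseteq> V"
      "\<And>K. K \<in> \<K> \<Longrightarrow> real (card K) \<le> \<beta> * real (card V)"
    and s: "3 * s \<le> 2 * r" "4 * real r * \<beta> \<le> real s + 1"
    and union: "4 * real r * 4 ^ s * ln (real (card \<K>)) < real (card V)"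
  shows "\<exists>L \<in> PiE V (\<lambda>_. nsets P r). \<forall>K \<in> PiE P (\<lambda>_. \<K>). L \<notin> PiE V (lists_meeting P r K)"
proof -
  let ?C = "real ((2 * r) choose r)" and ?\<delta> = "exp (- (real (card V) / (2 * 4 ^ s)))"
  let ?bad = "\<lambda>K. PiE V (lists_meeting P r K)"
  have fin_maps: "finite (PiE P (\<lambda>_. \<K>))" using P \<K>(1) by (intro finite_PiE) auto
  have "real (card \<K>) ^ (2 * r) \<le> exp (real (2 * r) * ln (real (card \<K>)))"
    by (cases "card \<K> = 0") (simp_all add: exp_of_nat_mult power_0_left del: of_nat_mult)
  then have "real (card \<K>) ^ (2 * r) * ?\<delta> \<le> exp (real (2 * r) * ln (real (card \<K>))) * ?\<delta>"
    by (rule mult_right_mono) simp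
  also have "\<dots> = exp (2 * real r * ln (real (card \<K>)) - real (card V) / (2 * 4 ^ s))"
    by (simp flip: exp_add)
  also have "\<dots> < 1" using union by (simp add: field_simps)
  finally have small: "real (card \<K>) ^ (2 * r) * ?\<delta> < 1" .
  have "real (card (\<Union>K \<in> PiE P (\<lambda>_. \<K>). ?bad K)) \<le> (\<Sum>K \<in> PiE P (\<lambda>_. \<K>). real (card (?bad K)))"
    using of_nat_mono[OF card_UN_le[OF fin_maps], where 'a = real] by simp
  also have "\<dots> \<le> (\<Sum>K \<in> PiE P (\<lambda>_. \<K>). ?C ^ card V * ?\<delta>)"
    using \<K>(2,3) by (intro sum_mono card_PiE_lists_meeting_le[OF V P _ _ s]) (auto simp: PiE_mem)
  also have "\<dots> = ?C ^ card V * (real (card \<K>) ^ (2 * r) * ?\<delta>)"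
    using P by (simp add: card_PiE)
  also have "\<dots> < ?C ^ card V * 1"
    using small by (intro mult_strict_left_mono zero_less_power) simp_all
  also have "\<dots> = real (card (PiE V (\<lambda>_. nsets P r)))"
    using V P by (simp add: card_PiE card_nsets)
  finally have fewer: "card (\<Union>K \<in> PiE P (\<lambda>_. \<K>). ?bad K) < card (PiE V (\<lambda>_. nsets P r))" by simp
  have "finite (?bad K)" for K
    using V P(1) by (intro finite_PiE) (simp_all add: lists_meeting_def finite_imp_finite_nsets)
  then have "finite (\<Union>K \<in> PiE P (\<lambda>_. \<K>). ?bad K)" using fin_maps by blast
  then have "\<not> PiE V (\<lambda>_. nsets P r) \<subseteq> (\<Union>K \<in> PiE P (\<lambda>_. \<K>). ?bad K)"
    using fewer by (meson card_mono leD)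
  then show ?thesis by (meson UN_I subsetI)
qed

section \<open>List dichromatic numbers\<close>

lemma list_dicolourable_mono:
  assumes "list_dicolourable D r" "r \<le> r'"
  shows "list_dicolourable D r'"
  unfolding list_dicolourable_def
proof (intro allI impI)
  fix L assume L: "list_assignment D r' L"
  have "\<exists>B \<subseteq> L v. card B = r \<and> finite B" if "v \<in> verts D" for v
    using L that assms(2) obtain_subset_with_card_n[of r "L v"]
    by (metis list_assignment_def)
  then obtain L' where L': "\<forall>v \<in> verts D. L' v \<subseteq> L v \<and> card (L' v) = r \<and> finite (L' v)"
    by metis
  then have "list_assignment D r L'"
    using L by (fastforce simp: list_assignment_def)
  then obtain f where "accepts D L' f" "proper_dicolouring D f"
    using assms(1) by (auto simp: list_dicolourable_def)
  then show "\<exists>f. accepts D L f \<and> proper_dicolouring D f"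
    using L' by (auto simp: accepts_def)
qed

lemma loopfree_digraph_orientation:
  assumes "pair_graph G" "orientation G D"
  shows "loopfree_digraph (with_proj D)"
proof
  interpret pair_graph G by fact
  fix e assume "e \<in> arcs (with_proj D)"
  then have e: "e \<in> parcs G" using assms(2) by (auto simp: orientation_def)
  then show "tail (with_proj D) e \<in> verts (with_proj D)"
    "head (with_proj D) e \<in> verts (with_proj D)"
    "tail (with_proj D) e \<noteq> head (with_proj D) e"
    using assms(2) in_arcsD1[of "fst e" "snd e"] in_arcsD2[of "fst e" "snd e"] pair_no_loops[OF e]
    by (simp_all add: orientation_def)
qed

lemma less_graph_list_dichromatic_number:
  assumes G: "pair_graph G" and D: "orientation G D" and r: "\<not> list_dicolourable (with_proj D) r"
  shows "r < graph_list_dichromatic_number G"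
proof -
  interpret pair_graph G by fact
  have "list_dicolourable (with_proj D) (card (verts (with_proj D)))"
    using D pair_finite_verts
    by (intro list_dicolourable_card_verts loopfree_digraph_orientation[OF G])
      (auto simp: orientation_def)
  then have "list_dicolourable (with_proj D) (list_dichromatic_number (with_proj D))"
    unfolding list_dichromatic_number_def by (rule LeastI)
  then have "r < list_dichromatic_number (with_proj D)"
    using r list_dicolourable_mono not_le by blast
  also have "\<dots> \<le> graph_list_dichromatic_number G"
    unfolding graph_list_dichromatic_number_def
  proof (rule Max_ge)
    show "finite {list_dichromatic_number (with_proj D) |D. orientation G D}"
      using finite_orientations[OF G] by simp
  qed (use D in blast)
  finally show ?thesis .
qed

lemma not_list_dicolourable_0:
  assumes "verts D \<noteq> {}"
  shows "\<not> list_dicolourable D 0"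
  using assms
  by (auto simp: list_dicolourable_def list_assignment_def accepts_def intro!: exI[of _ "\<lambda>_. {}"])

lemma graph_list_dichromatic_number_pos:
  assumes "pair_graph G" "pverts G \<noteq> {}"
  shows "0 < graph_list_dichromatic_number G"
proof -
  obtain D where D: "orientation G D" using ex_orientation[OF assms(1)] by blast
  then have "\<not> list_dicolourable (with_proj D) 0"
    using assms(2) by (intro not_list_dicolourable_0) (simp add: orientation_def)
  then show ?thesis by (rule less_graph_list_dichromatic_number[OF assms(1) D])
qed

lemma not_list_dicolourable_if_containers:
  assumes V: "finite (verts D)"
    and \<K>: "finite \<K>" "\<And>K. K \<in> \<K> \<Longrightarrow> K \<subseteq> verts D"
      "\<And>K. K \<in> \<K> \<Longrightarrow> real (card K) \<le> \<beta> * real (card (verts D))"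
    and cover: "\<And>F. F \<subseteq> verts D \<Longrightarrow> \<nexists>p. pre_digraph.cycle (D \<restriction> F) p \<Longrightarrow> \<exists>K \<in> \<K>. F \<subseteq> K"
    and s: "3 * s \<le> 2 * r" "4 * real r * \<beta> \<le> real s + 1"
    and union: "4 * real r * 4 ^ s * ln (real (card \<K>)) < real (card (verts D))"
  shows "\<not> list_dicolourable D r"
proof
  let ?P = "{1..2 * r}"
  obtain L where L: "L \<in> PiE (verts D) (\<lambda>_. nsets ?P r)"
    "\<forall>K \<in> PiE ?P (\<lambda>_. \<K>). L \<notin> PiE (verts D) (lists_meeting ?P r K)"
    using ex_lists_avoiding_containers[OF V _ _ \<K> s union, of ?P] by auto
  have lists: "L v \<in> nsets ?P r" if "v \<in> verts D" for v using L(1) that by (rule PiE_mem)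
  have "L v \<subseteq> {1..} \<and> finite (L v) \<and> card (L v) = r" if "v \<in> verts D" for v
    using lists[OF that] by (auto simp: nsets_def)
  then have "list_assignment D r L" by (simp add: list_assignment_def)
  moreover assume "list_dicolourable D r"
  ultimately obtain f where f: "accepts D L f" "proper_dicolouring D f"
    by (auto simp: list_dicolourable_def)
  have "\<exists>K \<in> \<K>. {v \<in> verts D. f v = c} \<subseteq> K" for c
    using f(2) by (intro cover) (auto simp: proper_dicolouring_def)
  then obtain K where K: "\<And>c. K c \<in> \<K>" "\<And>c. {v \<in> verts D. f v = c} \<subseteq> K c" by metis
  have "L \<in> PiE (verts D) (lists_meeting ?P r (restrict K ?P))"
  proof (rule PiE_I)
    show "L v = undefined" if "v \<notin> verts D" for v using L(1) that by (rule PiE_arb)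
    fix v assume v: "v \<in> verts D"
    then have "f v \<in> L v" using f(1) by (simp add: accepts_def)
    moreover have "f v \<in> ?P" using lists[OF v] calculation by (auto simp: nsets_def)
    then have "v \<in> restrict K ?P (f v)" using K(2)[of "f v"] v by auto
    ultimately show "L v \<in> lists_meeting ?P r (restrict K ?P) v"
      using lists[OF v] unfolding lists_meeting_def by blast
  qed
  moreover have "restrict K ?P \<in> PiE ?P (\<lambda>_. \<K>)" using K(1) by simp
  ultimately show False using L(2) by blast
qed

lemma acyclic_if_no_cycle:
  assumes "wf_digraph (with_proj D)"
    and "\<nexists>p. pre_digraph.cycle (with_proj D \<restriction> F) p"
  shows "acyclic (parcs D \<inter> F \<times> F)"
proof (rule ccontr)
  interpret wf_digraph "with_proj D \<restriction> F"
    using assms(1) by (rule wf_digraph.wellformed_induce_subgraph)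
  have ends: "arcs_ends (with_proj D \<restriction> F) = parcs D \<inter> F \<times> F"
    by (auto simp: arcs_ends_conv)
  assume "\<not> acyclic (parcs D \<inter> F \<times> F)"
  then obtain u where "(u, u) \<in> (arcs_ends (with_proj D \<restriction> F))\<^sup>+"
    by (auto simp: acyclic_def ends)
  then obtain p where "awalk u p u" "p \<noteq> []"
    by (auto simp: reachable1_awalk)
  then have "closed_w p" by (auto simp: closed_w_def)
  then show False using closed_w_imp_cycle assms(2) by blast
qed

lemma ex_orientation_no_cycle_sparse:
  assumes G: "pair_graph G" and d: "2 * card (pverts G) \<le> 2 ^ d"
  shows "\<exists>D. orientation G D \<and>
    (\<forall>F \<subseteq> pverts G. (\<nexists>p. pre_digraph.cycle (with_proj D \<restriction> F) p) \<longrightarrow> sparse_on (parcs G) d F)"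
proof -
  interpret pair_graph G by fact
  have "parcs G \<subseteq> pverts G \<times> pverts G" using in_arcsD1 in_arcsD2 by auto
  moreover have "sym (parcs G)" using pair_sym_arcs by (simp add: symmetric_def)
  moreover have "irrefl (parcs G)" using pair_no_loops by (fastforce simp: irrefl_def)
  ultimately obtain A where A: "A \<in> arc_orientations (parcs G)"
    "\<forall>F \<subseteq> pverts G. acyclic (A \<inter> F \<times> F) \<longrightarrow> sparse_on (parcs G) d F"
    using ex_orientation_acyclic_sparse[OF pair_finite_verts _ _ _ d] by blast
  define D where "D = \<lparr>pverts = pverts G, parcs = A\<rparr>"
  have D: "orientation G D" using A(1) by (auto simp: D_def orientation_def arc_orientations_def)
  then have "wf_digraph (with_proj D)"
    using loopfree_digraph_orientation[OF G] loopfree_digraph.axioms(1) by blast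
  then have "sparse_on (parcs G) d F"
    if "F \<subseteq> pverts G" "\<nexists>p. pre_digraph.cycle (with_proj D \<restriction> F) p" for F
    using that A(2) acyclic_if_no_cycle[of D F] by (simp add: D_def)
  with D show ?thesis by blast
qed

lemma pverts_kneser_graph: "pverts (kneser_graph n k) = nsets {1..n} k"
  by (auto simp: kneser_graph_def nsets_def intro: finite_subset)

lemma parcs_kneser_graph:
  "parcs (kneser_graph n k) = {(A, B). A \<inter> B = {}} \<inter> nsets {1..n} k \<times> nsets {1..n} k"
  by (auto simp: kneser_graph_def nsets_def intro: finite_subset)

lemma sparse_on_kneser_graph:
  assumes "F \<subseteq> nsets {1..n} k"
  shows "sparse_on (parcs (kneser_graph n k)) d F \<longleftrightarrow> sparse_on {(A, B). A \<inter> B = {}} d F"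
proof -
  have "parcs (kneser_graph n k) \<inter> U \<times> U = {(A, B). A \<inter> B = {}} \<inter> U \<times> U" if "U \<subseteq> F" for U
    using that assms by (auto simp: parcs_kneser_graph)
  then show ?thesis unfolding sparse_on_def by metis
qed

lemma less_graph_list_dichromatic_number_kneser_graph:
  fixes n k d t g r s :: nat and \<beta> :: real
  defines "N \<equiv> n choose k"
  assumes pos: "0 < k" "0 < d" "0 < t" and d: "2 * N \<le> 2 ^ d" and g: "(8 * k * d) ^ t \<le> g"
    and \<beta>: "core_density n k t * real N + 2 * real g \<le> \<beta> * real N"
    and s: "3 * s \<le> 2 * r" "4 * real r * \<beta> \<le> real s + 1"
    and union: "4 * real r * 4 ^ s * ln (real (container_count_bound n k t g)) < real N"
  shows "r < graph_list_dichromatic_number (kneser_graph n k)"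
proof -
  let ?G = "kneser_graph n k" and ?V = "nsets {1..n} k" and ?\<K> = "containers {1..n} k d t g"
  have G: "pair_graph ?G" by (rule pair_graph_kneser_graph[OF pos(1)])
  have V: "finite ?V" "card ?V = N" by (simp_all add: finite_imp_finite_nsets card_nsets N_def)
  obtain D where D: "orientation ?G D"
    "\<forall>F \<subseteq> ?V. (\<nexists>p. pre_digraph.cycle (with_proj D \<restriction> F) p) \<longrightarrow> sparse_on (parcs ?G) d F"
    using ex_orientation_no_cycle_sparse[OF G, of d] d V(2) unfolding pverts_kneser_graph by auto
  have verts_D: "verts (with_proj D) = ?V"
    using D(1) by (simp add: orientation_def pverts_kneser_graph)
  have "\<not> list_dicolourable (with_proj D) r"
  proof (rule not_list_dicolourable_if_containers[where \<K> = ?\<K>, OF _ _ _ _ _ s],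
      unfold verts_D V(2))
    show "finite ?V" by (rule V(1))
    show "finite ?\<K>" by (simp add: finite_containers)
    show "K \<subseteq> ?V" if "K \<in> ?\<K>" for K using that by (rule containers_subset_nsets)
    show "real (card K) \<le> \<beta> * real N" if "K \<in> ?\<K>" for K
      using card_container_le[OF _ pos(2) that] \<beta> by (simp add: N_def)
    fix F assume F: "F \<subseteq> ?V" "\<nexists>p. pre_digraph.cycle (with_proj D \<restriction> F) p"
    then have "sparse_on {(A, B). A \<inter> B = {}} d F"
      using D(2) sparse_on_kneser_graph[OF F(1)] by blast
    then show "\<exists>K \<in> ?\<K>. F \<subseteq> K" using F(1) pos g by (intro ex_container) auto
  next
    have "ln (real (card ?\<K>)) \<le> ln (real (container_count_bound n k t g))"
      using ln_card_containers_le[of "{1..n}"] by simp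
    then have "4 * real r * 4 ^ s * ln (real (card ?\<K>))
        \<le> 4 * real r * 4 ^ s * ln (real (container_count_bound n k t g))"
      by (rule mult_left_mono) simp
    with union show "4 * real r * 4 ^ s * ln (real (card ?\<K>)) < real N" by linarith
  qed
  then show ?thesis by (rule less_graph_list_dichromatic_number[OF G D(1)])
qed

section \<open>Choice of parameters\<close>

lemma powr_le_binomial:
  assumes "0 < k" "k \<le> n" "real k \<le> real n powr a"
  shows "real n powr ((1 - a) * real k) \<le> real (n choose k)"
proof -
  have n: "0 < real n" using assms by simp
  have "real n powr (1 - a) * real k \<le> real n powr (1 - a) * real n powr a"
    using assms(3) by (rule mult_left_mono) simp
  also have "\<dots> = real n" using n by (simp flip: powr_add)
  finally have "real n powr (1 - a) \<le> real n / real k" using assms(1) by (simp add: field_simps)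
  then have "(real n powr (1 - a)) ^ k \<le> (real n / real k) ^ k" by (rule power_mono) simp
  also have "\<dots> \<le> real (n choose k)" by (rule binomial_ge_n_over_k_pow_k[OF assms(2)])
  finally show ?thesis using n by (simp add: powr_powr flip: powr_realpow)
qed

lemma power_le_powr_of_square_le:
  assumes "2 \<le> k" "k\<^sup>2 \<le> n"
  shows "real k ^ p \<le> real ((p + 2) ^ p) * real n powr (real k / 2 - 1)"
proof -
  have "k ^ p \<le> (p + 2) ^ p * k ^ (k - 2)"
  proof (cases "p \<le> k - 2")
    case True
    then have "1 * k ^ p \<le> (p + 2) ^ p * k ^ (k - 2)"
      using assms(1) by (intro mult_le_mono one_le_power power_increasing) auto
    then show ?thesis by simp
  next
    case False
    then have "k ^ p * 1 \<le> (p + 2) ^ p * k ^ (k - 2)"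
      using assms(1) by (intro mult_le_mono one_le_power power_mono) auto
    then show ?thesis by simp
  qed
  from of_nat_mono[OF this, where 'a = real]
  have "real k ^ p \<le> real ((p + 2) ^ p) * real k ^ (k - 2)" by simp
  also have "real k ^ (k - 2) = real k powr real (k - 2)"
    using assms(1) by (intro powr_realpow[symmetric]) simp
  also have "\<dots> = (real k powr 2) powr (real k / 2 - 1)"
    unfolding powr_powr using assms(1) by (simp add: of_nat_diff right_diff_distrib)
  also have "\<dots> \<le> real n powr (real k / 2 - 1)"
    using assms of_nat_mono[OF assms(2), where 'a = real] by (intro powr_mono2) auto
  finally show ?thesis by (simp add: mult_left_mono)
qed

lemma ln_container_count_bound_le:
  assumes k: "1 \<le> k" "k \<le> n" and n: "2 \<le> n" and g: "1 \<le> g" "t \<le> g"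
  shows "ln (real (container_count_bound n k t g)) \<le> 8 * real g * real k * ln (real n)"
proof -
  define N where "N = n choose k"
  have "N \<le> n ^ k" unfolding N_def by (rule binomial_le_pow[OF k(2)])
  also have "\<dots> < (n + 1) ^ k" using k(1) by (intro power_strict_mono) auto
  finally have "N + 1 \<le> (n + 1) ^ k" by simp
  then have pow: "(N + 1) ^ i \<le> (n + 1) ^ (k * i)" for i
    unfolding power_mult by (rule power_mono) simp
  have gk: "g \<le> k * g" using k(1) by simp
  have "(n + 1) ^ t \<le> (n + 1) ^ (k * g)"
    by (rule power_increasing[OF order_trans[OF g(2) gk]]) simp
  then have "container_count_bound n k t g \<le> (2 * (n + 1) ^ (k * g)) * (n + 1) ^ (k * (2 * g))"
    using pow[of g] pow[of "2 * g"] unfolding container_count_bound_def N_def[symmetric]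
    by (intro mult_le_mono) linarith+
  also have "\<dots> = 2 * (n + 1) ^ (3 * (k * g))"
    by (simp flip: power_add add: algebra_simps)
  also have "\<dots> \<le> (n + 1) * (n + 1) ^ (3 * (k * g))" using n by (intro mult_le_mono) auto
  also have "\<dots> = (n + 1) ^ (3 * (k * g) + 1)" by simp
  also have "\<dots> \<le> (n + 1) ^ (4 * (k * g))" using gk g(1) by (intro power_increasing) auto
  also have "\<dots> \<le> (n\<^sup>2) ^ (4 * (k * g))"
  proof (rule power_mono)
    have "n + 1 \<le> n * 2" using n by simp
    also have "\<dots> \<le> n * n" using n by (rule mult_le_mono2)
    finally show "n + 1 \<le> n\<^sup>2" by (simp add: power2_eq_square)
  qed simp
  also have "\<dots> = n ^ (8 * g * k)" by (simp flip: power_mult add: ac_simps)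
  finally have "real (container_count_bound n k t g) \<le> real (n ^ (8 * g * k))" by (rule of_nat_mono)
  moreover have "0 < container_count_bound n k t g" by (simp add: container_count_bound_def)
  ultimately have "ln (real (container_count_bound n k t g)) \<le> ln (real (n ^ (8 * g * k)))"
    by (intro ln_mono) simp_all
  also have "\<dots> = 8 * real g * real k * ln (real n)"
    using n by (simp add: ln_realpow)
  finally show ?thesis .
qed

lemma eventually_ln_power_less_powr:
  fixes C \<epsilon> :: real
  assumes "0 < \<epsilon>"
  shows "\<forall>\<^sub>F n in sequentially. C * ln (real n) ^ p < real n powr \<epsilon>"
  using assms by real_asymp

lemma ex_pos_constant_if_eventually:
  fixes f :: "nat \<Rightarrow> 'a \<Rightarrow> real" and h :: "nat \<Rightarrow> real"
  assumes c: "0 < c" "\<forall>\<^sub>F n in sequentially. \<forall>a. P n a \<longrightarrow> c * h n \<le> f n a"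
    and f: "\<And>n a. P n a \<Longrightarrow> 1 \<le> f n a" and h: "\<And>n. 0 \<le> h n"
  shows "\<exists>c>0. \<forall>n a. P n a \<longrightarrow> c * h n \<le> f n a"
proof -
  obtain m where m: "\<And>n a. m \<le> n \<Longrightarrow> P n a \<Longrightarrow> c * h n \<le> f n a"
    using c(2) unfolding eventually_sequentially by blast
  define b where "b = 1 + (\<Sum>n<m. h n)"
  have b: "0 < b" unfolding b_def using h by (intro add_pos_nonneg sum_nonneg) auto
  have "min c (1 / b) * h n \<le> f n a" if "P n a" for n a
  proof (cases "m \<le> n")
    case True
    have "min c (1 / b) * h n \<le> c * h n" using h by (intro mult_right_mono) auto
    with m[OF True that] show ?thesis by linarith
  next
    case False
    then have "h n \<le> (\<Sum>n<m. h n)" using h by (intro member_le_sum) auto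
    then have "h n \<le> b" by (simp add: b_def)
    then have "1 / b * h n \<le> 1" using b by simp
    moreover have "min c (1 / b) * h n \<le> 1 / b * h n" using h by (intro mult_right_mono) auto
    ultimately show ?thesis using f[OF that] by linarith
  qed
  with c(1) b show ?thesis by (intro exI[of _ "min c (1 / b)"]) auto
qed

locale kneser_parameters =
  fixes \<epsilon> :: real and t n k :: nat
  assumes eps: "0 < \<epsilon>" "1 \<le> \<epsilon> * real t"
    and k: "2 \<le> k" "real k \<le> real n powr (1 / 2 - \<epsilon>)"
    and n: "2 ^ t \<le> n" "36 * (t + 1)\<^sup>2 \<le> n"
    and large: "32 * 24 ^ t * real ((2 * t + 1 + 2) ^ (2 * t + 1)) * ln (real n) ^ (t + 2)
      < real n powr \<epsilon>"
begin

definition sparsity :: nat where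
  "sparsity = nat \<lceil>2 * real k * ln (real n)\<rceil> + 1"

definition subfamily_bound :: nat where
  "subfamily_bound = (8 * k * sparsity) ^ t"

definition density :: real where
  "density = (real t + 1) * real k / real n"

text \<open>A container holds at most a fraction \<open>density\<close> of the vertices, so among twice
  \<open>list_length\<close> colours a typical vertex lies in the containers of at most \<open>multiplicity\<close> of them.\<close>

definition list_length :: nat where
  "list_length = nat \<lceil>\<epsilon> / (32 * (real t + 1)) * (real n * ln (real n))\<rceil>"

definition multiplicity :: nat where
  "multiplicity = nat \<lfloor>4 * real list_length * density\<rfloor>"

lemma t_pos: "0 < t"
  using eps by (cases t) auto

lemma n_ge_36: "36 \<le> n"
proof -
  have "36 * 1 \<le> 36 * (t + 1)\<^sup>2" by (intro mult_le_mono2 one_le_power) simp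
  with n(2) show ?thesis by linarith
qed

lemma ln_n_ge_1: "1 \<le> ln (real n)"
proof -
  have "exp 1 \<le> real n" using exp_le n_ge_36 by linarith
  then show ?thesis using n_ge_36 by (subst ln_ge_iff) auto
qed

lemma eps_less_half: "\<epsilon> < 1 / 2"
proof (rule ccontr)
  assume "\<not> \<epsilon> < 1 / 2"
  then have "real n powr (1 / 2 - \<epsilon>) \<le> real n powr 0" using n_ge_36 by (intro powr_mono) auto
  with k n_ge_36 show False by simp
qed

lemma square_k_le_powr: "(real k)\<^sup>2 \<le> real n powr (1 - 2 * \<epsilon>)"
proof -
  have "(real k)\<^sup>2 \<le> (real n powr (1 / 2 - \<epsilon>))\<^sup>2" using k by (intro power_mono) auto
  also have "\<dots> = real n powr ((1 / 2 - \<epsilon>) * 2)"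
    using n_ge_36 by (simp add: powr_powr flip: powr_numeral)
  finally show ?thesis by (simp add: algebra_simps)
qed

lemma square_k_le: "k\<^sup>2 \<le> n"
proof -
  have "(real k)\<^sup>2 \<le> real n powr 1"
    using eps n_ge_36 by (intro order_trans[OF square_k_le_powr] powr_mono) auto
  then have "real (k\<^sup>2) \<le> real n" by simp
  then show ?thesis by (simp only: of_nat_le_iff)
qed

lemma k_le_n: "k \<le> n"
  by (rule power2_nat_le_imp_le[OF square_k_le])

lemma powr_le_card_vertices: "real n powr (real k / 2 + \<epsilon> * real k) \<le> real (n choose k)"
  using powr_le_binomial[OF _ k_le_n k(2)] k(1) by (simp add: algebra_simps)

lemma twice_card_vertices_le: "2 * (n choose k) \<le> 2 ^ sparsity"
proof -
  let ?a = "nat \<lceil>2 * real k * ln (real n)\<rceil>"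
  have "1 / 2 \<le> ln (2 :: real)" using ln_le_minus_one[of "1 / 2"] by (simp add: ln_div)
  then have "2 * real k * ln (real n) * (1 / 2) \<le> 2 * real k * ln (real n) * ln 2"
    using ln_n_ge_1 by (intro mult_left_mono) auto
  also have "\<dots> \<le> real ?a * ln 2" by (intro mult_right_mono real_nat_ceiling_ge) simp
  finally have "ln (real (n ^ k)) \<le> ln (real (2 ^ ?a))" using n_ge_36 by (simp add: ln_realpow)
  then have "real (n ^ k) \<le> real (2 ^ ?a)" using n_ge_36 by (subst (asm) ln_le_cancel_iff) auto
  then have "n ^ k \<le> 2 ^ ?a" by (simp only: of_nat_le_iff)
  moreover have "n choose k \<le> n ^ k" by (rule binomial_le_pow[OF k_le_n])
  ultimately show ?thesis by (simp add: sparsity_def)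
qed

lemma sparsity_le: "real sparsity \<le> 3 * real k * ln (real n)"
proof -
  have "2 * 1 \<le> real k * ln (real n)" using k(1) ln_n_ge_1 by (intro mult_mono) auto
  then show ?thesis unfolding sparsity_def by simp linarith
qed

lemma subfamily_bound_le: "real subfamily_bound \<le> 24 ^ t * real k ^ (2 * t) * ln (real n) ^ t"
proof -
  have "real (8 * k * sparsity) = 8 * real k * real sparsity" by simp
  also have "\<dots> \<le> 8 * real k * (3 * real k * ln (real n))"
    by (rule mult_left_mono[OF sparsity_le]) simp
  also have "\<dots> = 24 * (real k)\<^sup>2 * ln (real n)" by (simp add: power2_eq_square)
  finally have "real (8 * k * sparsity) ^ t \<le> (24 * (real k)\<^sup>2 * ln (real n)) ^ t"
    by (rule power_mono) simp
  then show ?thesis by (simp add: subfamily_bound_def power_mult_distrib power_mult)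
qed

lemma t_le_subfamily_bound: "t \<le> subfamily_bound"
proof -
  have "t \<le> 2 ^ t" using less_exp[of t] by linarith
  also have "\<dots> \<le> subfamily_bound" unfolding subfamily_bound_def using k(1)
    by (intro power_mono) (auto simp: sparsity_def)
  finally show ?thesis .
qed

lemma subfamily_bound_less_powr:
  "32 * real subfamily_bound * real n * real k * (ln (real n))\<^sup>2 < real n powr (\<epsilon> + real k / 2)"
proof -
  let ?K = "real ((2 * t + 1 + 2) ^ (2 * t + 1))" and ?y = "real n powr (real k / 2 - 1)"
  have "32 * real subfamily_bound * real n * real k * (ln (real n))\<^sup>2
      = real subfamily_bound * (32 * real n * real k * (ln (real n))\<^sup>2)" by simp
  also have "\<dots> \<le> (24 ^ t * real k ^ (2 * t) * ln (real n) ^ t)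
      * (32 * real n * real k * (ln (real n))\<^sup>2)"
    using subfamily_bound_le by (rule mult_right_mono) simp
  also have "\<dots> = (32 * 24 ^ t * ln (real n) ^ (t + 2) * real n) * real k ^ (2 * t + 1)"
    by (simp add: power_add power2_eq_square)
  also have "\<dots> \<le> (32 * 24 ^ t * ln (real n) ^ (t + 2) * real n) * (?K * ?y)"
    by (rule mult_left_mono[OF power_le_powr_of_square_le[OF k(1) square_k_le]])
      (use ln_n_ge_1 in simp)
  also have "\<dots> = (32 * 24 ^ t * ?K * ln (real n) ^ (t + 2)) * (real n powr 1 * ?y)"
    by simp
  also have "real n powr 1 * ?y = real n powr (real k / 2)"
    unfolding powr_add[symmetric] by simp
  also have "(32 * 24 ^ t * ?K * ln (real n) ^ (t + 2)) * real n powr (real k / 2)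
      < real n powr \<epsilon> * real n powr (real k / 2)"
    using n_ge_36 by (intro mult_strict_right_mono large) auto
  finally show ?thesis by (simp add: powr_add)
qed

lemma core_density_eq: "core_density n k t = real t * (real k / real n)"
proof -
  have "(real k)\<^sup>2 / real n \<le> real n powr (1 - 2 * \<epsilon>) / real n powr 1"
    using divide_right_mono[OF square_k_le_powr, of "real n"] by simp
  then have "2 * (real k)\<^sup>2 / real n \<le> 2 * real n powr (- 2 * \<epsilon>)"
    unfolding powr_diff[symmetric] by simp
  then have "(2 * (real k)\<^sup>2 / real n) ^ t \<le> (2 * real n powr (- 2 * \<epsilon>)) ^ t"
    by (rule power_mono) simp
  also have "\<dots> = 2 ^ t * real n powr (- 2 * (\<epsilon> * real t))"
    using n_ge_36 by (simp add: power_mult_distrib powr_powr mult.assoc flip: powr_realpow)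
  also have "\<dots> \<le> real n * real n powr (- 2)"
    using of_nat_mono[OF n(1), where 'a = real] n_ge_36 eps by (intro mult_mono powr_mono) auto
  also have "\<dots> = 1 / real n" using n_ge_36 by (simp add: powr_minus power2_eq_square field_simps)
  also have "\<dots> \<le> real t * (real k / real n)"
  proof -
    have "1 * 1 \<le> real t * real k" using t_pos k by (intro mult_mono) auto
    then show ?thesis using n_ge_36 by (simp add: field_simps)
  qed
  finally show ?thesis by (simp add: core_density_def)
qed

lemma container_density_le:
  "core_density n k t * real (n choose k) + 2 * real subfamily_bound \<le> density * real (n choose k)"
proof -
  let ?N = "real (n choose k)"
  have "1 * 1 \<le> real k * (ln (real n))\<^sup>2"
    using k(1) ln_n_ge_1 by (intro mult_mono one_le_power) auto
  then have "2 * real subfamily_bound * real n * 1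
      \<le> 32 * real subfamily_bound * real n * (real k * (ln (real n))\<^sup>2)"
    by (intro mult_mono) auto
  also have "\<dots> = 32 * real subfamily_bound * real n * real k * (ln (real n))\<^sup>2" by simp
  also have "\<dots> \<le> real n powr (\<epsilon> + real k / 2)" using subfamily_bound_less_powr by simp
  also have "\<dots> \<le> real n powr (real k / 2 + \<epsilon> * real k)"
    using n_ge_36 k(1) eps(1) by (intro powr_mono) auto
  also have "\<dots> \<le> 1 * ?N" using powr_le_card_vertices by simp
  also have "\<dots> \<le> real k * ?N" using k(1) by (intro mult_right_mono) auto
  finally have "2 * real subfamily_bound \<le> real k * ?N / real n" using n_ge_36 by (simp add: field_simps)
  then show ?thesis
    unfolding core_density_eq density_def by (simp add: algebra_simps add_divide_distrib)
qed

lemma list_length_ge: "\<epsilon> / (32 * (real t + 1)) * (real n * ln (real n)) \<le> real list_length"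
  unfolding list_length_def by (rule real_nat_ceiling_ge)

lemma list_length_le: "real list_length \<le> \<epsilon> / (16 * (real t + 1)) * (real n * ln (real n))"
proof -
  have "32 * (real t + 1) * 1 \<le> 32 * (real t + 1) * (\<epsilon> * real t)"
    using eps(2) by (intro mult_left_mono) auto
  also have "\<dots> \<le> \<epsilon> * (36 * (real t + 1)\<^sup>2)"
    using eps(1) by (simp add: power2_eq_square algebra_simps)
  also have "\<dots> \<le> \<epsilon> * (real n * ln (real n))"
  proof (rule mult_left_mono)
    have "36 * (real t + 1)\<^sup>2 \<le> real n * 1"
      using of_nat_mono[OF n(2), where 'a = real] by (simp add: add.commute)
    also have "\<dots> \<le> real n * ln (real n)" using ln_n_ge_1 by (intro mult_left_mono) auto
    finally show "36 * (real t + 1)\<^sup>2 \<le> real n * ln (real n)" .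
  qed (use eps(1) in simp)
  finally have "1 \<le> \<epsilon> / (32 * (real t + 1)) * (real n * ln (real n))" by (simp add: field_simps)
  moreover have "real (nat \<lceil>y\<rceil>) \<le> 2 * y" if "1 \<le> y" for y :: real using that by linarith
  ultimately have "real list_length \<le> 2 * (\<epsilon> / (32 * (real t + 1)) * (real n * ln (real n)))"
    unfolding list_length_def by blast
  then show ?thesis by (simp add: field_simps)
qed

lemma
  shows multiplicity_le: "real multiplicity \<le> 4 * real list_length * density"
    and le_multiplicity: "4 * real list_length * density \<le> real multiplicity + 1"
proof -
  have "0 \<le> 4 * real list_length * density" by (simp add: density_def)
  then show "real multiplicity \<le> 4 * real list_length * density"
    "4 * real list_length * density \<le> real multiplicity + 1"
    unfolding multiplicity_def by linarith+
qed

lemma multiplicity_le_list_length: "3 * multiplicity \<le> 2 * list_length"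
proof -
  have "(6 * ((t + 1) * k))\<^sup>2 = 36 * (t + 1)\<^sup>2 * k\<^sup>2" unfolding power_mult_distrib by simp
  also have "\<dots> \<le> n * n" by (intro mult_le_mono n(2) square_k_le)
  finally have "6 * ((t + 1) * k) \<le> n" by (simp only: power2_nat_le_eq_le flip: power2_eq_square)
  from of_nat_mono[OF this, where 'a = real] have "6 * density \<le> 1"
    using n_ge_36 by (simp add: density_def field_simps)
  then have "real list_length * (6 * density) \<le> real list_length * 1" by (rule mult_left_mono) simp
  with multiplicity_le show ?thesis by linarith
qed

lemma four_power_multiplicity_le: "4 ^ multiplicity \<le> real n powr (\<epsilon> * real k / 2)"
proof -
  define u where "u = real t + 1"
  have u: "0 < u" by (simp add: u_def)
  have "real list_length * density \<le> (\<epsilon> / (16 * (real t + 1)) * (real n * ln (real n))) * density"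
    using list_length_le by (rule mult_right_mono) (simp add: density_def)
  also have "\<dots> = \<epsilon> * real k * ln (real n) / 16"
    using u n_ge_36 by (simp add: density_def flip: u_def)
  finally have "2 * real multiplicity \<le> \<epsilon> * real k / 2 * ln (real n)"
    using multiplicity_le by simp
  then have "exp (2 * real multiplicity) \<le> real n powr (\<epsilon> * real k / 2)"
    using n_ge_36 by (simp add: powr_def)
  moreover have "4 ^ multiplicity \<le> (exp 2 :: real) ^ multiplicity"
  proof (rule power_mono)
    have "(2::real)\<^sup>2 \<le> (exp 1)\<^sup>2" using exp_ge_add_one_self[of 1] by (intro power_mono) auto
    then show "4 \<le> (exp 2 :: real)" by (simp flip: exp_double)
  qed simp
  moreover have "(exp 2 :: real) ^ multiplicity = exp (2 * real multiplicity)"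
    by (simp flip: exp_of_nat_mult add: mult.commute)
  ultimately show ?thesis by linarith
qed

lemma container_union_bound:
  "4 * real list_length * 4 ^ multiplicity * ln (real (container_count_bound n k t subfamily_bound))
    < real (n choose k)"
proof -
  let ?\<Lambda> = "ln (real n)"
  have "\<epsilon> / (16 * (real t + 1)) * (real n * ?\<Lambda>) \<le> 1 * (real n * ?\<Lambda>)"
    using eps_less_half ln_n_ge_1 by (intro mult_right_mono) (auto simp: field_simps)
  with list_length_le have length: "real list_length \<le> real n * ?\<Lambda>" by simp
  have "4 * real list_length * 4 ^ multiplicity * ln (real (container_count_bound n k t subfamily_bound))
      \<le> 4 * real list_length * 4 ^ multiplicity * (8 * real subfamily_bound * real k * ?\<Lambda>)"
    using k(1) k_le_n n_ge_36 t_pos t_le_subfamily_bound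
    by (intro mult_left_mono ln_container_count_bound_le) auto
  also have "\<dots> \<le> 4 * (real n * ?\<Lambda>) * real n powr (\<epsilon> * real k / 2)
      * (8 * real subfamily_bound * real k * ?\<Lambda>)"
    using length four_power_multiplicity_le ln_n_ge_1 by (intro mult_mono) auto
  also have "\<dots> = (32 * real subfamily_bound * real n * real k * ?\<Lambda>\<^sup>2) * real n powr (\<epsilon> * real k / 2)"
    by (simp add: power2_eq_square)
  also have "\<dots> < real n powr (\<epsilon> + real k / 2) * real n powr (\<epsilon> * real k / 2)"
    using subfamily_bound_less_powr n_ge_36 by (intro mult_strict_right_mono) auto
  also have "\<dots> = real n powr (\<epsilon> + real k / 2 + \<epsilon> * real k / 2)" by (simp add: powr_add)
  also have "\<dots> \<le> real n powr (real k / 2 + \<epsilon> * real k)"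
  proof (rule powr_mono)
    have "\<epsilon> * 2 \<le> \<epsilon> * real k" using eps(1) k(1) by (intro mult_left_mono) auto
    then show "\<epsilon> + real k / 2 + \<epsilon> * real k / 2 \<le> real k / 2 + \<epsilon> * real k" by simp
  qed (use n_ge_36 in simp)
  also have "\<dots> \<le> real (n choose k)" by (rule powr_le_card_vertices)
  finally show ?thesis .
qed

lemma list_length_less: "list_length < graph_list_dichromatic_number (kneser_graph n k)"
  using k(1) t_pos
  by (intro less_graph_list_dichromatic_number_kneser_graph[OF _ _ _ twice_card_vertices_le _
        container_density_le multiplicity_le_list_length le_multiplicity container_union_bound])
    (auto simp: sparsity_def subfamily_bound_def)

lemma graph_list_dichromatic_number_kneser_graph_ge:
  "\<epsilon> / (32 * (real t + 1)) * (real n * ln (real n))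
    \<le> real (graph_list_dichromatic_number (kneser_graph n k))"
  using list_length_ge list_length_less by linarith

end

lemma eventually_kneser_parameters:
  assumes "0 < \<epsilon>" "1 \<le> \<epsilon> * real t"
  shows "\<forall>\<^sub>F n in sequentially. \<forall>k. 2 \<le> k \<and> real k \<le> real n powr (1 / 2 - \<epsilon>) \<longrightarrow>
    kneser_parameters \<epsilon> t n k"
  using eventually_ge_at_top[of "2 ^ t"] eventually_ge_at_top[of "36 * (t + 1)\<^sup>2"]
    eventually_ln_power_less_powr[OF assms(1),
      of "32 * 24 ^ t * real ((2 * t + 1 + 2) ^ (2 * t + 1))" "t + 2"]
  by eventually_elim (use assms in \<open>simp add: kneser_parameters_def\<close>)

lemma le_if_le_powr:
  assumes "real k \<le> real n powr a" "a \<le> 1"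
  shows "k \<le> n"
proof (cases "n = 0")
  case False
  then have "real n powr a \<le> real n powr 1" using assms(2) by (intro powr_mono) auto
  with assms(1) False show ?thesis by simp
qed (use assms(1) in simp)

lemma graph_list_dichromatic_number_kneser_graph_pos:
  assumes "0 < k" "k \<le> n"
  shows "0 < graph_list_dichromatic_number (kneser_graph n k)"
  using assms
  by (intro graph_list_dichromatic_number_pos pair_graph_kneser_graph)
    (simp_all add: pverts_kneser_graph nsets_eq_empty_iff)

theorem theorem15:
  fixes \<epsilon> :: real
  assumes "\<epsilon> > 0"
  shows "\<exists>c > 0. \<forall>n k :: nat. 2 \<le> k \<and> real k \<le> real n powr (1 / 2 - \<epsilon>) \<longrightarrow>
           real (graph_list_dichromatic_number (kneser_graph n k)) \<ge> c * real n * ln (real n)"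
proof -
  define t where "t = nat \<lceil>1 / \<epsilon>\<rceil>"
  have "1 / \<epsilon> \<le> real t" unfolding t_def by (rule real_nat_ceiling_ge)
  then have t: "1 \<le> \<epsilon> * real t" using assms by (simp add: field_simps)
  have "\<exists>c > 0. \<forall>n k. 2 \<le> k \<and> real k \<le> real n powr (1 / 2 - \<epsilon>) \<longrightarrow>
      c * (real n * ln (real n)) \<le> real (graph_list_dichromatic_number (kneser_graph n k))"
  proof (rule ex_pos_constant_if_eventually)
    show "0 < \<epsilon> / (32 * (real t + 1))" using assms by simp
    show "\<forall>\<^sub>F n in sequentially. \<forall>k. 2 \<le> k \<and> real k \<le> real n powr (1 / 2 - \<epsilon>) \<longrightarrow>
        \<epsilon> / (32 * (real t + 1)) * (real n * ln (real n))
          \<le> real (graph_list_dichromatic_number (kneser_graph n k))"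
      using eventually_kneser_parameters[OF assms t]
      by eventually_elim
        (blast intro: kneser_parameters.graph_list_dichromatic_number_kneser_graph_ge)
    show "1 \<le> real (graph_list_dichromatic_number (kneser_graph n k))"
      if "2 \<le> k \<and> real k \<le> real n powr (1 / 2 - \<epsilon>)" for n k
      using that assms le_if_le_powr[of k n "1 / 2 - \<epsilon>"]
        graph_list_dichromatic_number_kneser_graph_pos[of k n] by (simp add: Suc_le_eq)
    show "0 \<le> real n * ln (real n)" for n by (cases n) auto
  qed
  then show ?thesis by (simp add: mult.assoc)
qed

end
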